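(* Let $q\ge 6$ be a prime power, let $\Sigma_\infty$ be a hyperplane of $\mathrm{PG}(6,q)$ and $\mathcal S$ a regular $2$-spread of $\Sigma_\infty$. Let $\mathcal V$ be a ruled quintic surface positioned relative to $\mathcal S$ as in the context, with conic directrix $\mathcal C$ in the plane $\alpha\in\mathcal S$ and splash $\mathbb S\subset\mathcal S$. Let $\ell$ be a line of $\alpha$ with $|\ell\cap\mathcal C|=i$ and let $\pi\in\mathcal S$ with $\pi\neq\alpha$. Consider the $q$ $5$-spaces containing $\pi$ and $\ell$ and distinct from $\Sigma_\infty$. (1) If $\pi\in\mathbb S\setminus\{\alpha\}$, then $q-1$ of them meet $\mathcal V$ in a $5$-dim nrc, and $1$ meets $\mathcal V$ in a twisted cubic together with $i$ generators. (2) If $\pi\in\mathcal S\setminus\mathbb S$, then $q-i$ of them meet $\mathcal V$ in a $5$-dim nrc, and $i$ meet $\mathcal V$ in a $4$-dim nrc together with $1$ generator.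
   Context: Ruled quintic surface: in $\mathrm{PG}(6,q)$, take a non-degenerate conic $\mathcal C$ in a plane and a twisted cubic $\mathcal N_3$ in a $3$-space disjoint from that plane, parametrised as $\{(1,\theta,\theta^2)\}$ and $\{(1,\epsilon,\epsilon^2,\epsilon^3)\}$, and a projectivity $\phi\in\mathrm{PGL}(2,q)$ on parameters; $\mathcal V$ is the union of the $q+1$ lines (generators) joining each point of $\mathcal C$ to its image; $\mathcal C$ is the conic directrix. Bruck–Bose: a regular $2$-spread $\mathcal S$ of the $5$-space $\Sigma_\infty$ is a regular partition of its points into $q^3+1$ planes. The incidence structure whose points are the points of $\mathrm{PG}(6,q)\setminus\Sigma_\infty$ together with the planes of $\mathcal S$, and whose lines are the $3$-spaces meeting $\Sigma_\infty$ exactly in a plane of $\mathcal S$ together with a line $\ell_\infty$ whose points are the planes of $\mathcal S$, is isomorphic to $\mathrm{PG}(2,q^3)$. Positioning: $\mathcal V\cap\Sigma_\infty=\mathcal C$, $\mathcal C$ lies in a plane $\alpha\in\mathcal S$, and the affine points of $\mathcal V$ together with the point $\alpha\in\ell_\infty$ form an $\mathbb F_q$-subplane $\mathcal B$ of this $\mathrm{PG}(2,q^3)$ meeting $\ell_\infty$ only in $\alpha$. The splash $\mathbb S$ is the set of $q^2+1$ planes of $\mathcal S$ corresponding to points of $\ell_\infty$ lying on a line of $\mathrm{PG}(2,q^3)$ that meets $\mathcal B$ in an $\mathbb F_q$-subline ($q+1$ points). An $r$-dim nrc is a normal rational curve spanning an $r$-space; a twisted cubic is a $3$-dim nrc. "Meets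 $\mathcal V$ in $X$" means the intersection with $\mathcal V$ is exactly $X$. *)

theory Defs
  imports "HOL-Analysis.Cartesian_Space"
begin

text \<open>
  The projective space \<open>PG(n - 1, q)\<close> is the lattice of linear subspaces of \<^typ>\<open>'a ^ 'n\<close>,
  where \<^typ>\<open>'a\<close> is a finite field with \<open>q\<close> elements and \<open>n = CARD('n)\<close>. A projective subspace is
  given by its underlying linear subspace; sets of points are sets of one-dimensional subspaces.
\<close>

definition pspace :: "nat \<Rightarrow> ('a::field ^ 'n) set \<Rightarrow> bool"
  where "pspace k U \<longleftrightarrow> vec.subspace U \<and> vec.dim U = k + 1"

definition pts :: "('a::field ^ 'n) set \<Rightarrow> ('a ^ 'n) set set"
  where "pts U = {P. pspace 0 P \<and> P \<subseteq> U}"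

text \<open>
  Curves are parametrised by homogeneous parameters \<open>u = (u\<^sub>1, u\<^sub>2) \<noteq> 0\<close>; the parameter
  \<open>\<theta>\<close> corresponds to \<open>u = (1, \<theta>)\<close> and \<open>\<infinity>\<close> to \<open>u = (0, 1)\<close>. The vectors \<open>e 0, \<dots>, e r\<close> are the
  coordinate frame in which the curve has the form \<open>(1, \<theta>, \<dots>, \<theta>\<^sup>r)\<close>.
\<close>

definition frame :: "nat \<Rightarrow> (nat \<Rightarrow> 'a::field ^ 'n) \<Rightarrow> bool"
  where "frame r e \<longleftrightarrow> inj_on e {..r} \<and> vec.independent (e ` {..r})"

definition curve_pt :: "nat \<Rightarrow> (nat \<Rightarrow> 'a::field ^ 'n) \<Rightarrow> 'a ^ 2 \<Rightarrow> ('a ^ 'n) set"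
  where "curve_pt r e u = vec.span {\<Sum>i\<le>r. ((u $ 1) ^ (r - i) * (u $ 2) ^ i) *s e i}"

definition curve :: "nat \<Rightarrow> (nat \<Rightarrow> 'a::field ^ 'n) \<Rightarrow> ('a ^ 'n) set set"
  where "curve r e = {curve_pt r e u | u. u \<noteq> 0}"

text \<open>For \<open>r \<le> q\<close> the points of the curve span the \<open>r\<close>-space spanned by the frame.\<close>

definition nrc :: "nat \<Rightarrow> ('a::field ^ 'n) set set \<Rightarrow> bool"
  where "nrc r N \<longleftrightarrow> (\<exists>e. frame r e \<and> N = curve r e)"

text \<open>
  A ruled quintic surface with point set \<open>V\<close>, conic directrix \<open>C\<close> and set of generators \<open>G\<close>.
  The invertible matrix \<open>M\<close> represents the projectivity \<open>\<phi>\<close> on parameters.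
\<close>

definition ruled_quintic ::
    "('a::field ^ 7) set set \<Rightarrow> ('a ^ 7) set set \<Rightarrow> ('a ^ 7) set set \<Rightarrow> bool"
  where "ruled_quintic V C G \<longleftrightarrow>
    (\<exists>e f (M :: 'a ^ 2 ^ 2).
       frame 2 e \<and> frame 3 f \<and>
       pts (vec.span (e ` {..2})) \<inter> pts (vec.span (f ` {..3})) = {} \<and>
       invertible M \<and>
       C = curve 2 e \<and>
       G = {vec.span (curve_pt 2 e u \<union> curve_pt 3 f (M *v u)) | u. u \<noteq> 0} \<and>
       V = (\<Union>g\<in>G. pts g))"

definition regulus2 :: "('a::{field,finite} ^ 'n) set set \<Rightarrow> bool"
  where "regulus2 R \<longleftrightarrow>
    (\<forall>\<rho>\<in>R. pspace 2 \<rho>) \<and> card R = CARD('a) + 1 \<and>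
    (\<forall>\<rho>\<in>R. \<forall>\<sigma>\<in>R. \<rho> \<noteq> \<sigma> \<longrightarrow> pts \<rho> \<inter> pts \<sigma> = {}) \<and>
    (\<forall>m. pspace 1 m \<and>
         (\<exists>\<rho>\<^sub>1\<in>R. \<exists>\<rho>\<^sub>2\<in>R. \<exists>\<rho>\<^sub>3\<in>R. \<rho>\<^sub>1 \<noteq> \<rho>\<^sub>2 \<and> \<rho>\<^sub>1 \<noteq> \<rho>\<^sub>3 \<and> \<rho>\<^sub>2 \<noteq> \<rho>\<^sub>3 \<and>
            pts m \<inter> pts \<rho>\<^sub>1 \<noteq> {} \<and> pts m \<inter> pts \<rho>\<^sub>2 \<noteq> {} \<and> pts m \<inter> pts \<rho>\<^sub>3 \<noteq> {})
       \<longrightarrow> (\<forall>\<rho>\<in>R. pts m \<inter> pts \<rho> \<noteq> {}))"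

definition spread2 :: "('a::field ^ 'n) set \<Rightarrow> ('a ^ 'n) set set \<Rightarrow> bool"
  where "spread2 \<Sigma> S \<longleftrightarrow>
    (\<forall>\<rho>\<in>S. pspace 2 \<rho> \<and> \<rho> \<subseteq> \<Sigma>) \<and> (\<forall>P\<in>pts \<Sigma>. \<exists>!\<rho>. \<rho> \<in> S \<and> P \<in> pts \<rho>)"

text \<open>
  Three pairwise disjoint planes of a 5-space lie in exactly one 2-regulus; a 2-spread is regular
  if it contains, with any three of its planes, the 2-regulus determined by them.
\<close>

definition regular_spread2 :: "('a::{field,finite} ^ 'n) set \<Rightarrow> ('a ^ 'n) set set \<Rightarrow> bool"
  where "regular_spread2 \<Sigma> S \<longleftrightarrow> spread2 \<Sigma> S \<and>
    (\<forall>\<rho>\<^sub>1\<in>S. \<forall>\<rho>\<^sub>2\<in>S. \<forall>\<rho>\<^sub>3\<in>S. \<rho>\<^sub>1 \<noteq> \<rho>\<^sub>2 \<and> \<rho>\<^sub>1 \<noteq> \<rho>\<^sub>3 \<and> \<rho>\<^sub>2 \<noteq> \<rho>\<^sub>3 \<longrightarrow>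
       (\<exists>R. regulus2 R \<and> {\<rho>\<^sub>1, \<rho>\<^sub>2, \<rho>\<^sub>3} \<subseteq> R \<and> R \<subseteq> S))"

text \<open>
  The Bruck--Bose plane. Its points are the affine points (one-dimensional subspaces) and the
  spread planes (three-dimensional subspaces), so the two kinds are disjoint. Its lines are
  represented as sets of points; the line at infinity is \<open>S\<close> itself.
\<close>

definition bb_points :: "('a::field ^ 'n) set \<Rightarrow> ('a ^ 'n) set set \<Rightarrow> ('a ^ 'n) set set"
  where "bb_points \<Sigma> S = (pts UNIV - pts \<Sigma>) \<union> S"

definition bb_lines :: "('a::field ^ 'n) set \<Rightarrow> ('a ^ 'n) set set \<Rightarrow> ('a ^ 'n) set set set"
  where "bb_lines \<Sigma> S =
    {(pts U - pts \<Sigma>) \<union> {U \<inter> \<Sigma>} | U. pspace 3 U \<and> U \<inter> \<Sigma> \<in> S} \<union> {S}"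

text \<open>
  An \<open>F\<^sub>q\<close>-subplane is a subplane isomorphic to \<open>PG(2, q)\<close>, and an \<open>F\<^sub>q\<close>-subline is a line of
  an \<open>F\<^sub>q\<close>-subplane. The map \<open>\<beta>\<close> embeds \<open>PG(2, q)\<close>, preserving and reflecting collinearity.
\<close>

definition Fq_embedding ::
    "('a::field ^ 'n) set \<Rightarrow> ('a ^ 'n) set set \<Rightarrow> (('a ^ 3) set \<Rightarrow> ('a ^ 'n) set) \<Rightarrow> bool"
  where "Fq_embedding \<Sigma> S \<beta> \<longleftrightarrow>
    inj_on \<beta> (pts UNIV) \<and> \<beta> ` pts UNIV \<subseteq> bb_points \<Sigma> S \<and>
    (\<forall>X\<in>pts UNIV. \<forall>Y\<in>pts UNIV. \<forall>Z\<in>pts UNIV.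
       (\<exists>m. pspace 1 m \<and> {X, Y, Z} \<subseteq> pts m) \<longleftrightarrow>
       (\<exists>L\<in>bb_lines \<Sigma> S. {\<beta> X, \<beta> Y, \<beta> Z} \<subseteq> L))"

definition Fq_subplane ::
    "('a::field ^ 'n) set \<Rightarrow> ('a ^ 'n) set set \<Rightarrow> ('a ^ 'n) set set \<Rightarrow> bool"
  where "Fq_subplane \<Sigma> S B \<longleftrightarrow> (\<exists>\<beta>. Fq_embedding \<Sigma> S \<beta> \<and> B = \<beta> ` pts UNIV)"

definition Fq_subline ::
    "('a::field ^ 'n) set \<Rightarrow> ('a ^ 'n) set set \<Rightarrow> ('a ^ 'n) set set \<Rightarrow> bool"
  where "Fq_subline \<Sigma> S b \<longleftrightarrow>
    (\<exists>\<beta> m. Fq_embedding \<Sigma> S \<beta> \<and> pspace 1 m \<and> b = \<beta> ` pts m)"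

definition splash ::
    "('a::field ^ 'n) set \<Rightarrow> ('a ^ 'n) set set \<Rightarrow> ('a ^ 'n) set set \<Rightarrow> ('a ^ 'n) set set"
  where "splash \<Sigma> S B = {\<rho>\<in>S. \<exists>L\<in>bb_lines \<Sigma> S. \<rho> \<in> L \<and> Fq_subline \<Sigma> S (L \<inter> B)}"

definition five_spaces ::
    "('a::field ^ 'n) set \<Rightarrow> ('a ^ 'n) set \<Rightarrow> ('a ^ 'n) set \<Rightarrow> ('a ^ 'n) set set"
  where "five_spaces \<Sigma> \<pi> l = {H. pspace 5 H \<and> \<pi> \<subseteq> H \<and> l \<subseteq> H \<and> H \<noteq> \<Sigma>}"

text \<open>The 5-space \<open>H\<close> meets \<open>V\<close> exactly in an \<open>r\<close>-dimensional nrc together with \<open>k\<close> generators.\<close>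

definition meets_in_nrc_and_generators ::
    "('a::field ^ 'n) set set \<Rightarrow> ('a ^ 'n) set set \<Rightarrow> nat \<Rightarrow> nat \<Rightarrow> ('a ^ 'n) set \<Rightarrow> bool"
  where "meets_in_nrc_and_generators V G r k H \<longleftrightarrow>
    (\<exists>N K. nrc r N \<and> K \<subseteq> G \<and> card K = k \<and> pts H \<inter> V = N \<union> (\<Union>g\<in>K. pts g))"

end

theory Submission
  imports Defs "HOL-Computational_Algebra.Polynomial"
begin

text \<open>
  After reparametrising the twisted cubic, the generators join points \<open>c(u)\<close> and \<open>n(u)\<close>, where \<open>c\<close>
  and \<open>n\<close> are vectors of binary forms of degree 2 and 3. A hyperplane \<open>h = 0\<close> restricts to a
  pair \<open>(h\<^sub>2, h\<^sub>3) = (h \<circ> c, h \<circ> n)\<close> of binary forms and meets the generator \<open>u\<close> in the point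
  \<open>h\<^sub>3(u) c(u) - h\<^sub>2(u) n(u)\<close>, or contains it if \<open>u\<close> is a common root. Cancelling the common
  factor of \<open>h\<^sub>2\<close> and \<open>h\<^sub>3\<close>, of degree 0, 1 or 2, leaves a normal rational curve of dimension 5, 4 or 3.

  The 5-spaces through \<open>\<pi>\<close> and \<open>l\<close> other than \<open>\<Sigma>\<close> belong to the pairs \<open>(h\<^sub>2, h\<^sub>3 + k g)\<close>, where \<open>h\<^sub>2\<close>
  vanishes at the \<open>i\<close> points of \<open>l\<close> on the conic and \<open>\<Sigma>\<close> belongs to \<open>(0, g)\<close>, with \<open>g\<close> free of roots.
  So every root of \<open>h\<^sub>2\<close> is a common root for exactly one \<open>k\<close>, and all depends on whether \<open>h\<^sub>2\<close> divides
  some \<open>h\<^sub>3 + k g\<close>. This happens exactly for \<open>\<pi>\<close> in the splash: a line of the subplane not through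
  \<open>\<alpha>\<close> is a 3-space spanned by the points \<open>m(u) c(u) + n(u)\<close> for a linear form \<open>m\<close>, because
  binary forms of degree less than \<open>q\<close> are determined by their values; every \<open>m\<close> occurs; and \<open>h\<close>
  vanishes on at most one plane of the spread, as two of them span \<open>\<Sigma>\<close>.
\<close>

section \<open>Binary forms\<close>

text \<open>Forms are functions rather than polynomials, so identities and common zeros are compared
  pointwise. The price is that coefficients can be recovered from the values only when the degree is
  small against \<open>q\<close>, which is where the degree bounds below come from. The zero
  function is a form of every degree.\<close>

definition form :: "nat \<Rightarrow> ('a::field ^ 2 \<Rightarrow> 'a) \<Rightarrow> bool"
  where "form r p \<longleftrightarrow> (\<exists>a. \<forall>u. p u = (\<Sum>i\<le>r. ((u $ 1) ^ (r - i) * (u $ 2) ^ i) * a i))"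

lemma formI: "(\<And>u. p u = (\<Sum>i\<le>r. ((u $ 1) ^ (r - i) * (u $ 2) ^ i) * a i)) \<Longrightarrow> form r p"
  unfolding form_def by (rule exI[of _ a]) simp

lemma formE:
  assumes "form r p"
  obtains a where "\<forall>u. p u = (\<Sum>i\<le>r. ((u $ 1) ^ (r - i) * (u $ 2) ^ i) * a i)"
  using assms that unfolding form_def by blast

lemma form_add:
  assumes "form r p" "form r p'"
  shows "form r (\<lambda>u. p u + p' u)"
proof -
  obtain a where a: "\<forall>u. p u = (\<Sum>i\<le>r. ((u $ 1) ^ (r - i) * (u $ 2) ^ i) * a i)"
    by (rule formE[OF assms(1)])
  obtain b where b: "\<forall>u. p' u = (\<Sum>i\<le>r. ((u $ 1) ^ (r - i) * (u $ 2) ^ i) * b i)"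
    by (rule formE[OF assms(2)])
  show ?thesis
    by (rule formI[where a = "\<lambda>i. a i + b i"]) (simp add: a b distrib_left sum.distrib)
qed

lemma form_cmult:
  assumes "form r p"
  shows "form r (\<lambda>u. k * p u)"
proof -
  obtain a where a: "\<forall>u. p u = (\<Sum>i\<le>r. ((u $ 1) ^ (r - i) * (u $ 2) ^ i) * a i)"
    by (rule formE[OF assms])
  show ?thesis
    by (rule formI[where a = "\<lambda>i. k * a i"]) (simp add: a sum_distrib_left mult_ac)
qed

lemma form_diff: "form r p \<Longrightarrow> form r p' \<Longrightarrow> form r (\<lambda>u. p u - p' u)"
  using form_add[of r p "\<lambda>u. (-1) * p' u"] form_cmult[of r p' "-1"] by simp

lemma form_uminus: "form r p \<Longrightarrow> form r (\<lambda>u. - p u)"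
  using form_cmult[of r p "-1"] by simp

lemma form_zero: "form r (\<lambda>u. 0)"
  unfolding form_def by (intro exI[of _ "\<lambda>i. 0"]) simp

lemma form_sum: "(\<And>i. i \<in> A \<Longrightarrow> form r (p i)) \<Longrightarrow> form r (\<lambda>u. \<Sum>i\<in>A. p i u)"
  by (induction A rule: infinite_finite_induct) (auto intro: form_add form_zero)

lemma form_0: "form 0 (\<lambda>u. k)"
  unfolding form_def by (intro exI[of _ "\<lambda>i. k"]) simp

lemma form_fst_mult:
  assumes "form r p"
  shows "form (Suc r) (\<lambda>u. u $ 1 * p u)"
proof -
  obtain a where a: "\<forall>u. p u = (\<Sum>i\<le>r. ((u $ 1) ^ (r - i) * (u $ 2) ^ i) * a i)"
    by (rule formE[OF assms])
  show ?thesis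
    by (rule formI[where a = "\<lambda>i. if i \<le> r then a i else 0"])
      (simp add: a sum_distrib_left Suc_diff_le mult.assoc)
qed

lemma form_snd_mult:
  assumes "form r p"
  shows "form (Suc r) (\<lambda>u. u $ 2 * p u)"
proof -
  obtain a where a: "\<forall>u. p u = (\<Sum>i\<le>r. ((u $ 1) ^ (r - i) * (u $ 2) ^ i) * a i)"
    by (rule formE[OF assms])
  show ?thesis
    by (rule formI[where a = "\<lambda>i. case i of 0 \<Rightarrow> 0 | Suc j \<Rightarrow> a j"], unfold sum.atMost_Suc_shift)
      (simp add: a sum_distrib_left mult_ac)
qed

lemma form_monomial_mult: "form r p \<Longrightarrow> form (j + k + r) (\<lambda>u. (u $ 1) ^ j * (u $ 2) ^ k * p u)"
proof (induction j)
  case 0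
  then show ?case
  proof (induction k)
    case (Suc k)
    then show ?case using form_snd_mult[of "k + r" "\<lambda>u. (u $ 2) ^ k * p u"] by (simp add: mult_ac)
  qed simp
next
  case (Suc j)
  then show ?case
    using form_fst_mult[of "j + k + r" "\<lambda>u. (u $ 1) ^ j * (u $ 2) ^ k * p u"]
    by (simp add: mult_ac)
qed

lemma form_mult: 
  assumes "form r p" "form s p'"
  shows "form (r + s) (\<lambda>u. p u * p' u)"
proof -
  obtain a where a: "\<forall>u. p u = (\<Sum>i\<le>r. ((u $ 1) ^ (r - i) * (u $ 2) ^ i) * a i)"
    by (rule formE[OF assms(1)])
  have "form (r + s) (\<lambda>u. \<Sum>i\<le>r. a i * ((u $ 1) ^ (r - i) * (u $ 2) ^ i * p' u))"
  proof (intro form_sum form_cmult)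
    fix i assume "i \<in> {..r}"
    then show "form (r + s) (\<lambda>u. (u $ 1) ^ (r - i) * (u $ 2) ^ i * p' u)"
      using form_monomial_mult[OF assms(2), of "r - i" i] by simp
  qed
  then show ?thesis by (simp add: a sum_distrib_left sum_distrib_right mult_ac)
qed

lemma form_power: "form 1 p \<Longrightarrow> form k (\<lambda>u. p u ^ k)"
proof (induction k)
  case (Suc k)
  then show ?case using form_mult[of 1 p k "\<lambda>u. p u ^ k"] by simp
qed (simp add: form_0)

lemma form_fst: "form 1 (\<lambda>u. u $ 1)"
  using form_fst_mult[OF form_0[of 1]] by simp

lemma form_snd: "form 1 (\<lambda>u. u $ 2)"
  using form_snd_mult[OF form_0[of 1]] by simp

lemma form_compose_matrix:
  assumes "form r p"
  shows "form r (\<lambda>u. p (M *v u))"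
proof -
  obtain a where a: "\<forall>u. p u = (\<Sum>i\<le>r. ((u $ 1) ^ (r - i) * (u $ 2) ^ i) * a i)"
    by (rule formE[OF assms])
  have lin: "form 1 (\<lambda>u. (M *v u) $ j)" for j
    using form_add[OF form_cmult[OF form_fst] form_cmult[OF form_snd]]
    by (simp add: matrix_vector_mult_def sum_2)
  have "form r (\<lambda>u. \<Sum>i\<le>r. a i * (((M *v u) $ 1) ^ (r - i) * ((M *v u) $ 2) ^ i))"
  proof (intro form_sum form_cmult)
    fix i assume "i \<in> {..r}"
    then show "form r (\<lambda>u. ((M *v u) $ 1) ^ (r - i) * ((M *v u) $ 2) ^ i)"
      using form_mult[OF form_power[OF lin[of 1], of "r - i"] form_power[OF lin[of 2], of i]] by simp
  qed
  then show ?thesis by (simp add: a mult_ac)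
qed

lemma form_scale:
  assumes "form r p"
  shows "p (k *s u) = k ^ r * p u"
proof -
  obtain a where a: "\<forall>u. p u = (\<Sum>i\<le>r. ((u $ 1) ^ (r - i) * (u $ 2) ^ i) * a i)"
    by (rule formE[OF assms])
  have "(k * u $ 1) ^ (r - i) * (k * u $ 2) ^ i = k ^ r * ((u $ 1) ^ (r - i) * (u $ 2) ^ i)"
    if "i \<le> r" for i
  proof -
    have "k ^ r = k ^ (r - i) * k ^ i" using that by (simp flip: power_add)
    then show ?thesis by (simp add: power_mult_distrib)
  qed
  then show ?thesis by (simp add: a sum_distrib_left mult.assoc)
qed

section \<open>Zeros of forms and cancellation\<close>

text \<open>On the points \<open>(1, x)\<close> the form is the one-variable polynomial with
  coefficients \<open>a\<close>, of degree at most \<open>r\<close>, and more than \<open>r\<close>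
  zeros kill it. The set \<open>X\<close> stays arbitrary because
  \<open>linear_directrix_form\<close> has to leave out \<open>x = 0\<close>.\<close>

lemma form_coeffs_zero:
  fixes p :: "'a::field ^ 2 \<Rightarrow> 'a"
  assumes p: "\<And>u. p u = (\<Sum>i\<le>r. ((u $ 1) ^ (r - i) * (u $ 2) ^ i) * a i)"
    and X: "finite X" "r < card X" "\<And>x. x \<in> X \<Longrightarrow> p (vector [1, x]) = 0"
    and "i \<le> r"
  shows "a i = 0"
proof -
  define P where "P = (\<Sum>i\<le>r. monom (a i) i)"
  have poly: "poly P x = p (vector [1, x])" for x
    by (simp add: P_def p poly_sum poly_monom mult.commute)
  have coeff: "coeff P j = (if j \<le> r then a j else 0)" for j
    by (simp add: P_def coeff_sum)
  have "P = 0"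
  proof (rule ccontr)
    assume "P \<noteq> 0"
    have "card X \<le> card {x. poly P x = 0}"
      using X poly \<open>P \<noteq> 0\<close> by (intro card_mono poly_roots_finite) auto
    also have "\<dots> \<le> degree P" using \<open>P \<noteq> 0\<close> by (rule card_poly_roots_bound)
    also have "\<dots> \<le> r" by (rule degree_le) (simp add: coeff)
    finally show False using X by simp
  qed
  then show ?thesis using coeff[of i] \<open>i \<le> r\<close> by simp
qed

lemma form_eq_0:
  assumes "form r p" "finite X" "r < card X" "\<And>x. x \<in> X \<Longrightarrow> p (vector [1, x]) = 0"
  shows "p u = 0"
proof -
  obtain a where a: "\<forall>u. p u = (\<Sum>i\<le>r. ((u $ 1) ^ (r - i) * (u $ 2) ^ i) * a i)"
    by (rule formE[OF assms(1)])
  then show ?thesis using form_coeffs_zero[OF a[rule_format] assms(2-4)] by simp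
qed

lemma vector_1_neq_0: "vector [1, x] \<noteq> (0 :: 'a::field ^ 2)"
  by (metis vector_2(1) zero_index zero_neq_one)

text \<open>Non-zero forms of degrees \<open>r\<close> and \<open>s\<close> vanish at no more than
  \<open>r\<close> and \<open>s\<close> of the \<open>q\<close> points \<open>(1, x)\<close>, so
  their zeros cannot cover all of these points.\<close>

lemma form_no_zero_divisors:
  fixes p p' :: "'a::{field,finite} ^ 2 \<Rightarrow> 'a"
  assumes "form r p" "form s p'" "r + s < CARD('a)" "\<And>u. u \<noteq> 0 \<Longrightarrow> p u * p' u = 0"
  shows "(\<forall>u. p u = 0) \<or> (\<forall>u. p' u = 0)"
proof (rule ccontr)
  assume no: "\<not> ?thesis"
  let ?X = "{x. p (vector [1, x]) = 0}" and ?Y = "{x. p' (vector [1, x]) = 0}"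
  have "card ?X \<le> r"
  proof (rule ccontr)
    assume "\<not> card ?X \<le> r"
    then have "r < card ?X" by simp
    from form_eq_0[OF assms(1) finite this] have "p u = 0" for u by blast
    with no show False by blast
  qed
  moreover have "card ?Y \<le> s"
  proof (rule ccontr)
    assume "\<not> card ?Y \<le> s"
    then have "s < card ?Y" by simp
    from form_eq_0[OF assms(2) finite this] have "p' u = 0" for u by blast
    with no show False by blast
  qed
  moreover have "?X \<union> ?Y = UNIV" using assms(4)[OF vector_1_neq_0] by auto
  then have "CARD('a) \<le> card ?X + card ?Y" by (metis card_Un_le)
  ultimately show False using assms(3) by simp
qed

text \<open>The cancellation rule: an identity between forms that holds wherever a non-zero factor
  \<open>p'\<close> does not vanish holds everywhere, provided the total degree stays below
  \<open>q\<close>.\<close>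

lemma form_eq_0_if_nonzero:
  fixes p :: "'a::{field,finite} ^ 2 \<Rightarrow> 'a"
  assumes "form r p" "form s p'" "r + s < CARD('a)" "\<And>u. u \<noteq> 0 \<Longrightarrow> p' u \<noteq> 0 \<Longrightarrow> p u = 0"
    and "p' v \<noteq> 0"
  shows "p u = 0"
  using form_no_zero_divisors[OF assms(1-3)] assms(4,5) by fastforce

section \<open>Splitting off linear factors\<close>

lemma form_Suc_cases:
  assumes "form (Suc r) p"
  obtains p' b where "form r p'" "\<forall>u. p u = u $ 1 * p' u + b * (u $ 2) ^ Suc r"
proof -
  obtain a where a: "\<forall>u. p u = (\<Sum>i\<le>Suc r. ((u $ 1) ^ (Suc r - i) * (u $ 2) ^ i) * a i)"
    by (rule formE[OF assms])
  show ?thesis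
  proof
    show "form r (\<lambda>u. \<Sum>i\<le>r. ((u $ 1) ^ (r - i) * (u $ 2) ^ i) * a i)"
      by (rule formI) simp
    show "\<forall>u. p u = u $ 1 * (\<Sum>i\<le>r. ((u $ 1) ^ (r - i) * (u $ 2) ^ i) * a i) + a (Suc r) * (u $ 2) ^ Suc r"
      by (simp add: a sum_distrib_left Suc_diff_le mult.assoc mult.commute[of "a _"])
  qed
qed

text \<open>The factor \<open>w\<^sub>1 u\<^sub>2 - w\<^sub>2 u\<^sub>1\<close> is the linear form with root \<open>w\<close>.\<close>

lemma form_remainder:
  fixes w :: "'a::field ^ 2"
  assumes "form (Suc r) p" "w $ 2 \<noteq> 0"
  shows "\<exists>p' b. form r p' \<and> (\<forall>u. p u = (w $ 1 * u $ 2 - w $ 2 * u $ 1) * p' u + b * (u $ 2) ^ Suc r)"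
  using assms(1)
proof (induction r arbitrary: p)
  case 0
  obtain p' b where p': "form 0 p'" "\<forall>u. p u = u $ 1 * p' u + b * (u $ 2) ^ Suc 0"
    by (rule form_Suc_cases[OF 0])
  obtain a where a: "\<forall>u. p' u = a" using formE[OF p'(1)] by auto
  define k where "k = a / w $ 2"
  have k: "a = k * w $ 2" using assms(2) by (simp add: k_def)
  have "p u = (w $ 1 * u $ 2 - w $ 2 * u $ 1) * (- k) + (b + k * w $ 1) * (u $ 2) ^ Suc 0" for u
    by (simp add: p' a k algebra_simps)
  then show ?case using form_0[of "- k"] by blast
next
  case (Suc r)
  obtain p' b where p': "form (Suc r) p'" "\<forall>u. p u = u $ 1 * p' u + b * (u $ 2) ^ Suc (Suc r)"
    by (rule form_Suc_cases[OF Suc.prems])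
  obtain p'' a where p'': "form r p''"
    "\<And>u. p' u = (w $ 1 * u $ 2 - w $ 2 * u $ 1) * p'' u + a * (u $ 2) ^ Suc r"
    using Suc.IH[OF p'(1)] by blast
  \<comment> \<open>The leftover term \<open>a * u $ 1 * (u $ 2) ^ Suc r\<close> is reduced by
    replacing \<open>w $ 2 * u $ 1\<close> with \<open>w $ 1 * u $ 2\<close> minus the linear form,
    which turns it into a multiple of a pure power of \<open>u $ 2\<close>.\<close>
  define k where "k = a / w $ 2"
  have k: "a = k * w $ 2" using assms(2) by (simp add: k_def)
  have form: "form (Suc r) (\<lambda>u. u $ 1 * p'' u - k * (u $ 2) ^ Suc r)"
    by (intro form_diff form_fst_mult form_cmult form_power form_snd p'')
  have "p u = (w $ 1 * u $ 2 - w $ 2 * u $ 1) * (u $ 1 * p'' u - k * (u $ 2) ^ Suc r)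
      + (b + k * w $ 1) * (u $ 2) ^ Suc (Suc r)" for u
    unfolding p'(2)[rule_format] p''(2) k by (simp add: algebra_simps)
  then show ?case using form by blast
qed

lemma form_factor:
  fixes w :: "'a::field ^ 2"
  assumes "form (Suc r) p" "w \<noteq> 0" "p w = 0"
  obtains p' where "form r p'" "\<And>u. p u = (w $ 1 * u $ 2 - w $ 2 * u $ 1) * p' u"
proof (cases "w $ 2 = 0")
  case False
  with form_remainder[OF assms(1)] obtain p' b where p': "form r p'"
    "\<And>u. p u = (w $ 1 * u $ 2 - w $ 2 * u $ 1) * p' u + b * (u $ 2) ^ Suc r" by blast
  with assms(3) False have "b = 0" by simp
  with p' that show ?thesis by simp
next
  \<comment> \<open>The root is the point \<open>(1 : 0)\<close>, where only the term with
    \<open>a 0\<close> survives. So \<open>u $ 2\<close> divides the form, and the linear form is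
    \<open>w $ 1 * u $ 2\<close>.\<close>
  case True
  have w1: "w $ 1 \<noteq> 0" using True \<open>w \<noteq> 0\<close> by (auto simp: vec_eq_iff forall_2)
  obtain a where a: "\<forall>u. p u = (\<Sum>i\<le>Suc r. ((u $ 1) ^ (Suc r - i) * (u $ 2) ^ i) * a i)"
    by (rule formE[OF assms(1)])
  have a0: "a 0 = 0" using assms(3) True w1 unfolding a[rule_format] sum.atMost_Suc_shift by simp
  define p' where "p' u = (\<Sum>i\<le>r. ((u $ 1) ^ (r - i) * (u $ 2) ^ i) * a (Suc i))" for u :: "'a ^ 2"
  have "form r p'" by (rule formI[where a = "\<lambda>i. a (Suc i)"]) (simp add: p'_def)
  moreover have "p u = u $ 2 * p' u" for u
    unfolding a[rule_format] sum.atMost_Suc_shift p'_def by (simp add: a0 sum_distrib_left mult_ac)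
  ultimately show ?thesis 
    using that[of "\<lambda>u. 1 / w $ 1 * p' u"] form_cmult[of r p' "1 / w $ 1"] w1 True by simp
qed

lemma linear_form_cases:
  assumes "form 1 p"
  obtains a b where "\<forall>u. p u = a * u $ 1 + b * u $ 2"
proof -
  obtain a where a: "\<forall>u. p u = (\<Sum>i\<le>1. ((u $ 1) ^ (1 - i) * (u $ 2) ^ i) * a i)"
    by (rule formE[OF assms])
  show ?thesis by (rule that[of "a 0" "a 1"]) (simp add: a mult.commute)
qed

lemma linear_form_root:
  assumes "form 1 p"
  obtains w where "w \<noteq> 0" "p w = 0"
proof -
  obtain a b where p: "\<forall>u. p u = a * u $ 1 + b * u $ 2" by (rule linear_form_cases[OF assms])
  show ?thesis
  proof (cases "a = 0")
    case True
    then show ?thesis using that[OF vector_1_neq_0[of 0]] by (simp add: p)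
  next
    case False
    then have "vector [- b, a] \<noteq> (0 :: 'a ^ 2)" by (metis vector_2(2) zero_index)
    then show ?thesis using that by (simp add: p)
  qed
qed

lemma proportional_if_det_0:
  fixes u v :: "'a::field ^ 2"
  assumes "u \<noteq> 0" "u $ 1 * v $ 2 = u $ 2 * v $ 1"
  obtains k where "v = k *s u"
proof (cases "u $ 1 = 0")
  case True
  then have "u $ 2 \<noteq> 0" using assms(1) by (auto simp: vec_eq_iff forall_2)
  with True assms(2) have "v = (v $ 2 / u $ 2) *s u" by (auto simp: vec_eq_iff forall_2)
  then show ?thesis using that by blast
next
  case False
  with assms(2) have "v = (v $ 1 / u $ 1) *s u" by (auto simp: vec_eq_iff forall_2 field_simps)
  then show ?thesis using that by blast
qed

section \<open>Linear functionals and points\<close>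

definition lfun :: "('a::field ^ 'n \<Rightarrow> 'a) \<Rightarrow> bool"
  where "lfun h \<longleftrightarrow> (\<forall>x y. h (x + y) = h x + h y) \<and> (\<forall>k x. h (k *s x) = k * h x)"

lemma
  assumes "lfun h"
  shows lfun_add: "h (x + y) = h x + h y"
    and lfun_scale: "h (k *s x) = k * h x"
    and lfun_0: "h 0 = 0"
    and lfun_diff: "h (x - y) = h x - h y"
proof -
  show add: "h (x + y) = h x + h y" for x y using assms by (simp add: lfun_def)
  show "h (k *s x) = k * h x" for k x using assms by (simp add: lfun_def)
  from this[of 0 0] show "h 0 = 0" by simp
  show "h (x - y) = h x - h y" using add[of "x - y" y] by simp
qed

lemma lfun_sum:
  assumes "lfun h"
  shows "h (\<Sum>i\<in>A. g i) = (\<Sum>i\<in>A. h (g i))"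
  by (induction A rule: infinite_finite_induct) (simp_all add: lfun_0 lfun_add assms)

lemma lfun_combine: "lfun h \<Longrightarrow> lfun g \<Longrightarrow> lfun (\<lambda>x. h x + k * g x)"
  by (simp add: lfun_def algebra_simps)

lemma subspace_kernel: "lfun h \<Longrightarrow> vec.subspace {x. h x = 0}"
  by (simp add: vec.subspace_def lfun_0 lfun_add lfun_scale)

section \<open>Separating functionals and hyperplanes\<close>

text \<open>The duality tool for all spanning arguments: a span is shown to be large by showing that
  a functional vanishing on it must vanish at the given vector too.\<close>

lemma lfun_separating:
  fixes x :: "'a::field ^ 'n"
  assumes "vec.subspace W" "x \<notin> W"
  obtains h where "lfun h" "\<forall>y\<in>W. h y = 0" "h x = 1"
proof -
  obtain B where B: "B \<subseteq> W" "vec.independent B" "W \<subseteq> vec.span B"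
    by (rule vec.basis_exists[of W])
  have "vec.span B \<subseteq> W" using B(1) assms(1) by (rule vec.span_minimal)
  then have "x \<notin> vec.span B" using assms(2) by blast
  then have "vec.independent (insert x B)" using B(2) by (rule vec.independent_insertI)
  \<comment> \<open>The linear extension takes vectors as values, so the value 1 is encoded as the
    all-one vector; reading any one coordinate then gives a scalar functional.\<close>
  then obtain g :: "'a ^ 'n \<Rightarrow> 'a ^ 'n" where g: "Vector_Spaces.linear (*s) (*s) g"
    "\<forall>y\<in>insert x B. g y = (if y = x then (\<chi> j. 1) else 0)"
    using vec.linear_independent_extend[of _ "\<lambda>y. if y = x then (\<chi> j. 1) else 0"] by blast
  define h where "h y = g y $ undefined" for y
  have B0: "g y = 0" if "y \<in> B" for y using g(2) that B(1) assms(2) by auto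
  have "g y = 0" if "y \<in> vec.span B" for y
    by (rule vec.linear_eq_0_on_span[OF g(1) B0 that])
  then have "\<forall>y\<in>W. h y = 0" using B(3) by (auto simp: h_def)
  moreover have "lfun h"
    by (simp add: lfun_def h_def vec.linear_add[OF g(1)] vec.linear_scale[OF g(1)])
  moreover have "h x = 1" using g(2) by (simp add: h_def)
  ultimately show ?thesis using that by blast
qed

lemma dim_kernel:
  fixes x :: "'a::field ^ 'n"
  assumes "lfun h" "h x \<noteq> 0"
  shows "vec.dim {y. h y = 0} + 1 = CARD('n)"
proof -
  let ?K = "{y. h y = 0}"
  have "y \<in> vec.span (insert x ?K)" for y
    unfolding vec.span_breakdown_eq
    by (rule exI[of _ "h y / h x"], rule vec.span_base) 
      (simp add: lfun_diff lfun_scale assms)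
  then have "vec.span (insert x ?K) = UNIV" by blast
  then have "vec.dim (insert x ?K) = CARD('n)" by (metis vec.dim_span vec_dim_card)
  moreover have "x \<notin> vec.span ?K" 
    using assms by (simp add: vec.span_eq_iff[THEN iffD2, OF subspace_kernel])
  ultimately show ?thesis by (simp add: vec.dim_insert)
qed

lemma hyperplane_kernel:
  fixes H :: "('a::field ^ 'n) set"
  assumes "vec.subspace H" "vec.dim H + 1 = CARD('n)"
  obtains h x where "lfun h" "h x \<noteq> 0" "H = {y. h y = 0}"
proof -
  have "H \<noteq> UNIV" using assms(2) by (auto simp: card_cart_basis)
  then obtain x where "x \<notin> H" by blast
  then obtain h where h: "lfun h" "\<forall>y\<in>H. h y = 0" "h x = 1"
    using lfun_separating[OF assms(1)] by blast
  have "H = {y. h y = 0}"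
  proof (rule vec.subspace_dim_equal[OF assms(1) subspace_kernel[OF h(1)]])
    show "vec.dim {y. h y = 0} \<le> vec.dim H" using dim_kernel[OF h(1), of x] h(3) assms(2) by simp
  qed (use h in auto)
  with h that show ?thesis by force
qed

text \<open>Subtracting the right multiple of a vector \<open>x\<close> with
  \<open>g x \<noteq> 0\<close> moves each vector of \<open>U\<close> into the kernel of
  \<open>g\<close>. This is what makes hyperplanes with a common trace a pencil.\<close>

lemma lfun_proportional_on:
  assumes "lfun h" "lfun g" "vec.subspace U" "\<And>y. y \<in> U \<Longrightarrow> g y = 0 \<Longrightarrow> h y = 0"
  obtains k where "\<forall>y\<in>U. h y = k * g y"
proof (cases "\<forall>y\<in>U. g y = 0")
  case True
  then show ?thesis using assms(4) that[of 0] by simp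
next
  case False
  then obtain x where x: "x \<in> U" "g x \<noteq> 0" by blast
  have "h y = (h x / g x) * g y" if "y \<in> U" for y
  proof -
    have "y - (g y / g x) *s x \<in> U"
      using that x(1) assms(3) by (intro vec.subspace_diff vec.subspace_scale)
    then have "h (y - (g y / g x) *s x) = 0"
      using assms(4) x(2) by (simp add: lfun_diff lfun_scale assms(2))
    then show ?thesis by (simp add: lfun_diff lfun_scale assms(1))
  qed
  then show ?thesis using that by blast
qed

lemma dim_Int_ge:
  assumes "vec.subspace S" "vec.subspace T" "vec.subspace U" "S \<subseteq> U" "T \<subseteq> U"
  shows "vec.dim S + vec.dim T \<le> vec.dim U + vec.dim (S \<inter> T)"
proof -
  have "{x + y |x y. x \<in> S \<and> y \<in> T} \<subseteq> U"
    using assms by (auto intro: vec.subspace_add)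
  then have "vec.dim {x + y |x y. x \<in> S \<and> y \<in> T} \<le> vec.dim U" by (rule vec.dim_subset)
  with vec.dim_sums_Int[OF assms(1,2)] show ?thesis by simp
qed

section \<open>Points as one-dimensional subspaces\<close>

lemma nonzero_if_dim_pos:
  assumes "0 < vec.dim S"
  obtains x where "x \<in> S" "x \<noteq> 0"
proof -
  have "\<not> S \<subseteq> {0}"
  proof
    assume "S \<subseteq> {0}"
    then have "vec.dim S = 0" using vec.dim_le_card[of S "{}"] by simp
    with assms show False by simp
  qed
  with that show ?thesis by blast
qed

lemma dim_singleton: "x \<noteq> 0 \<Longrightarrow> vec.dim {x} = 1"
  using vec.dim_insert[of x "{}"] by simp

lemma span_singleton_subset: "vec.subspace U \<Longrightarrow> vec.span {x} \<subseteq> U \<longleftrightarrow> x \<in> U"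
  by (meson empty_subsetI insert_subset vec.span_base vec.span_minimal subset_iff insertI1)

lemma span_singleton_eqD:
  assumes "vec.span {x} = vec.span {y}" "y \<noteq> 0"
  obtains k where "k \<noteq> 0" "y = k *s x"
proof -
  have "y \<in> vec.span {x}" by (simp add: assms vec.span_base)
  then obtain k where "y = k *s x" by (auto simp: vec.span_singleton)
  with assms(2) that[of k] show ?thesis by auto
qed

lemma span_singleton_scale: "k \<noteq> 0 \<Longrightarrow> vec.span {k *s x} = vec.span {x}"
proof -
  assume "k \<noteq> 0"
  then have "x = (1 / k) *s (k *s x)" by simp
  then have "x \<in> vec.span {k *s x}" by (metis vec.span_base vec.span_scale singletonI)
  then show ?thesis
    by (intro equalityI) (simp_all add: span_singleton_subset vec.span_base vec.span_scale)
qed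

lemma pspace_0_iff: "pspace 0 P \<longleftrightarrow> (\<exists>x. x \<noteq> 0 \<and> P = vec.span {x})"
proof
  assume P: "pspace 0 P"
  then obtain x where x: "x \<in> P" "x \<noteq> 0" unfolding pspace_def by (metis nonzero_if_dim_pos add_0 zero_less_one)
  have "vec.span {x} = P"
    by (rule vec.subspace_dim_equal) (use P x in \<open>auto simp: pspace_def span_singleton_subset dim_singleton\<close>)
  with x show "\<exists>x. x \<noteq> 0 \<and> P = vec.span {x}" by blast
qed (auto simp: pspace_def dim_singleton)

lemma pts_iff: "vec.subspace U \<Longrightarrow> P \<in> pts U \<longleftrightarrow> (\<exists>x. x \<noteq> 0 \<and> x \<in> U \<and> P = vec.span {x})"
  unfolding pts_def pspace_0_iff using span_singleton_subset by blast

lemma span_in_pts_iff: "vec.subspace U \<Longrightarrow> x \<noteq> 0 \<Longrightarrow> vec.span {x} \<in> pts U \<longleftrightarrow> x \<in> U"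
  by (auto simp: pts_def pspace_0_iff span_singleton_subset)

text \<open>Together with \<open>card_nrc_le\<close> this shows that a normal rational curve
  containing a line would be that line.\<close>

lemma card_pts_span_ge:
  fixes x y :: "'a::{field,finite} ^ 'n"
  assumes "y \<noteq> 0" "\<And>k. x \<noteq> k *s y"
  shows "CARD('a) + 1 \<le> card (pts (vec.span {x, y}))"
proof -
  let ?f = "\<lambda>k. vec.span {x + k *s y}"
  have x: "x \<in> vec.span {x, y}" and y: "y \<in> vec.span {x, y}" by (simp_all add: vec.span_base)
  have nz: "x + k *s y \<noteq> 0" for k
  proof
    assume "x + k *s y = 0"
    then have "x = (- k) *s y" by (simp add: eq_neg_iff_add_eq_0)
    with assms(2) show False by blast
  qed
  have coeff: "a = b \<and> c = d" if eq: "a *s x + c *s y = b *s x + d *s y" for a b c d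
  proof -
    have ab: "(a - b) *s x = (d - c) *s y" using eq by (simp add: algebra_simps vec.scale_left_diff_distrib)
    have "a - b = 0"
    proof (rule ccontr)
      assume "a - b \<noteq> 0"
      then have "x = (1 / (a - b)) *s ((a - b) *s x)" by simp
      also have "\<dots> = ((d - c) / (a - b)) *s y" by (simp add: ab)
      finally show False using assms(2) by blast
    qed
    with ab assms(1) show ?thesis by simp
  qed
  have "inj ?f"
  proof (rule injI)
    fix a b assume "?f a = ?f b"
    then obtain k where "x + b *s y = k *s (x + a *s y)" using span_singleton_eqD nz by metis
    then have "1 *s x + b *s y = k *s x + (k * a) *s y" by (simp add: vec.scale_right_distrib)
    from coeff[OF this] show "a = b" by simp
  qed
  moreover have "vec.span {y} \<notin> range ?f"
  proof
    assume "vec.span {y} \<in> range ?f"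
    then obtain k where "vec.span {x + k *s y} = vec.span {y}" by auto
    then obtain c where "c \<noteq> 0" "y = c *s (x + k *s y)" using span_singleton_eqD assms(1) by metis
    then have "0 *s x + 1 *s y = c *s x + (c * k) *s y" by (simp add: vec.scale_right_distrib)
    from coeff[OF this] \<open>c \<noteq> 0\<close> show False by simp
  qed
  ultimately have "card (insert (vec.span {y}) (range ?f)) = CARD('a) + 1"
    by (simp add: card_image)
  moreover have "insert (vec.span {y}) (range ?f) \<subseteq> pts (vec.span {x, y})"
    using assms(1) x y nz by (auto simp: span_in_pts_iff vec.span_add vec.span_scale)
  ultimately show ?thesis by (metis card_mono finite)
qed

section \<open>Vector-valued forms and normal rational curves\<close>

definition vform :: "nat \<Rightarrow> ('a::field ^ 2 \<Rightarrow> 'a ^ 'n) \<Rightarrow> bool"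
  where "vform r w \<longleftrightarrow> (\<forall>j. form r (\<lambda>u. w u $ j))"

lemma vform_iff:
  "vform r w \<longleftrightarrow> (\<exists>e. \<forall>u. w u = (\<Sum>i\<le>r. ((u $ 1) ^ (r - i) * (u $ 2) ^ i) *s e i))"
proof
  assume "vform r w"
  then have "\<forall>j. \<exists>a. \<forall>u. w u $ j = (\<Sum>i\<le>r. ((u $ 1) ^ (r - i) * (u $ 2) ^ i) * a i)"
    by (simp add: vform_def form_def)
  then obtain a where "\<forall>j u. w u $ j = (\<Sum>i\<le>r. ((u $ 1) ^ (r - i) * (u $ 2) ^ i) * a j i)"
    by metis
  then have "\<forall>u. w u = (\<Sum>i\<le>r. ((u $ 1) ^ (r - i) * (u $ 2) ^ i) *s (\<chi> j. a j i))"
    by (simp add: vec_eq_iff)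
  then show "\<exists>e. \<forall>u. w u = (\<Sum>i\<le>r. ((u $ 1) ^ (r - i) * (u $ 2) ^ i) *s e i)"
    by (intro exI[of _ "\<lambda>i. \<chi> j. a j i"])
next
  assume "\<exists>e. \<forall>u. w u = (\<Sum>i\<le>r. ((u $ 1) ^ (r - i) * (u $ 2) ^ i) *s e i)"
  then obtain e where e: "\<forall>u. w u = (\<Sum>i\<le>r. ((u $ 1) ^ (r - i) * (u $ 2) ^ i) *s e i)" ..
  show "vform r w"
    unfolding vform_def
  proof
    fix j
    show "form r (\<lambda>u. w u $ j)" by (rule formI[where a = "\<lambda>i. e i $ j"]) (simp add: e)
  qed
qed

lemma vform_diff: "vform r w \<Longrightarrow> vform r w' \<Longrightarrow> vform r (\<lambda>u. w u - w' u)"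
  by (simp add: vform_def form_diff)

lemma vform_mult: "form r p \<Longrightarrow> vform s w \<Longrightarrow> vform (r + s) (\<lambda>u. p u *s w u)"
  by (simp add: vform_def form_mult)

lemma vform_compose_matrix: "vform r w \<Longrightarrow> vform r (\<lambda>u. w (M *v u))"
  unfolding vform_def
  using form_compose_matrix by fastforce

lemma vform_scale: "vform r w \<Longrightarrow> w (k *s u) = k ^ r *s w u"
  by (simp add: vec_eq_iff vform_def form_scale[of r "\<lambda>u. w u $ _"])

lemma form_lfun_vform:
  assumes "lfun h" "vform r w"
  shows "form r (\<lambda>u. h (w u))"
proof -
  obtain e where "\<forall>u. w u = (\<Sum>i\<le>r. ((u $ 1) ^ (r - i) * (u $ 2) ^ i) *s e i)"
    using assms(2) unfolding vform_iff by blast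
  then show ?thesis
    by (intro formI[where a = "\<lambda>i. h (e i)"]) (simp add: lfun_sum lfun_scale assms(1))
qed

text \<open>A functional \<open>h\<close> that vanishes on all values gives a form with coefficients
  \<open>h (e i)\<close> and \<open>q\<close> zeros \<open>(1, x)\<close>. As \<open>r < q\<close>,
  it vanishes on the coefficient vectors as well.\<close>

lemma span_vform:
  fixes e :: "nat \<Rightarrow> 'a::{field,finite} ^ 'n" and w :: "'a ^ 2 \<Rightarrow> 'a ^ 'n"
  assumes w: "\<And>u. w u = (\<Sum>i\<le>r. ((u $ 1) ^ (r - i) * (u $ 2) ^ i) *s e i)"
    and "r < CARD('a)"
  shows "vec.span {w u | u. u \<noteq> 0} = vec.span (e ` {..r})"
proof
  have "w u \<in> vec.span (e ` {..r})" for u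
    unfolding w by (intro vec.span_sum vec.span_scale vec.span_base) auto
  then show "vec.span {w u | u. u \<noteq> 0} \<subseteq> vec.span (e ` {..r})"
    by (intro vec.span_minimal) auto
  have "e i \<in> vec.span {w u | u. u \<noteq> 0}" if "i \<le> r" for i
  proof (rule ccontr)
    assume "e i \<notin> vec.span {w u | u. u \<noteq> 0}"
    then obtain h where h: "lfun h" "\<forall>y\<in>vec.span {w u | u. u \<noteq> 0}. h y = 0" "h (e i) = 1"
      by (rule lfun_separating[OF vec.subspace_span])
    have "h (e i) = 0"
    proof (rule form_coeffs_zero[where X = UNIV])
      show "h (w u) = (\<Sum>i\<le>r. ((u $ 1) ^ (r - i) * (u $ 2) ^ i) * h (e i))" for u
        by (simp add: w lfun_sum lfun_scale h(1))
      show "h (w (vector [1, x])) = 0" for x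
        by (rule h(2)[rule_format], rule vec.span_base) (use vector_1_neq_0 in auto)
    qed (use that assms(2) in auto)
    with h(3) show False by simp
  qed
  then show "vec.span (e ` {..r}) \<subseteq> vec.span {w u | u. u \<noteq> 0}"
    by (intro vec.span_minimal) auto
qed

lemma frame_if_dim:
  assumes "r + 1 \<le> vec.dim (e ` {..r})"
  shows "frame r e"
proof -
  have "vec.dim (e ` {..r}) \<le> card (e ` {..r})" by (intro vec.dim_le_card vec.span_superset) simp
  moreover have "card (e ` {..r}) \<le> r + 1" using card_image_le[of "{..r}" e] by simp
  ultimately have card: "card (e ` {..r}) = r + 1" using assms by simp
  then have "inj_on e {..r}" by (intro eq_card_imp_inj_on) simp_all
  moreover have "vec.independent (e ` {..r})"
    by (rule vec.card_le_dim_spanning[OF order_refl vec.span_superset]) (use card assms in simp_all)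
  ultimately show ?thesis by (simp add: frame_def)
qed

lemma dim_frame: "frame r e \<Longrightarrow> vec.dim (e ` {..r}) = r + 1"
  by (simp add: frame_def vec.dim_eq_card_independent card_image)

text \<open>Reduces every later claim about normal rational curves to a dimension count: the values
  lie in the span of \<open>r + 1\<close> coefficient vectors, which must form a frame once the
  values span \<open>r + 1\<close> dimensions.\<close>

lemma nrc_if_vform:
  assumes "vform r w" "r + 1 \<le> vec.dim {w u | u. u \<noteq> 0}"
  shows "nrc r {vec.span {w u} | u. u \<noteq> 0}"
proof -
  obtain e where e: "\<forall>u. w u = (\<Sum>i\<le>r. ((u $ 1) ^ (r - i) * (u $ 2) ^ i) *s e i)"
    using assms(1) unfolding vform_iff by blast
  have "w u \<in> vec.span (e ` {..r})" for u
    unfolding e[rule_format] by (intro vec.span_sum vec.span_scale vec.span_base) auto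
  then have "vec.dim {w u | u. u \<noteq> 0} \<le> vec.dim (vec.span (e ` {..r}))"
    by (intro vec.dim_subset) auto
  with assms(2) have "frame r e" by (intro frame_if_dim) simp
  moreover have "{vec.span {w u} | u. u \<noteq> 0} = curve r e"
    by (simp add: curve_def curve_pt_def e)
  ultimately show ?thesis unfolding nrc_def by blast
qed

section \<open>Span and size of normal rational curves\<close>

lemma dim_nrc:
  fixes N :: "('a::{field,finite} ^ 'n) set set"
  assumes "nrc r N" "r < CARD('a)"
  shows "vec.dim (\<Union>N) = r + 1"
proof -
  obtain e where e: "frame r e" "N = curve r e" using assms(1) unfolding nrc_def by blast
  define w where "w u = (\<Sum>i\<le>r. ((u $ 1) ^ (r - i) * (u $ 2) ^ i) *s e i)" for u :: "'a ^ 2"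
  have N: "N = {vec.span {w u} | u. u \<noteq> 0}" by (simp add: e(2) curve_def curve_pt_def w_def)
  have "vec.span (\<Union>N) = vec.span {w u | u. u \<noteq> 0}"
  proof (rule vec.span_eq[THEN iffD2], intro conjI subsetI)
    show "x \<in> vec.span {w u | u. u \<noteq> 0}" if x: "x \<in> \<Union>N" for x
    proof -
      obtain u where "u \<noteq> 0" "x \<in> vec.span {w u}" using x unfolding N by auto
      moreover from this(1) have "vec.span {w u} \<subseteq> vec.span {w u | u. u \<noteq> 0}"
        by (intro vec.span_mono) blast
      ultimately show ?thesis by blast
    qed
    show "x \<in> vec.span (\<Union>N)" if "x \<in> {w u | u. u \<noteq> 0}" for x
      using that unfolding N by (intro vec.span_base) (auto intro: vec.span_base)
  qed
  then show ?thesis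
    using dim_frame[OF e(1)] span_vform[OF w_def assms(2)] by (metis vec.dim_span)
qed

text \<open>Up to a scalar, which by homogeneity does not move the point, the parameters are
  \<open>(0, 1)\<close> and the \<open>q\<close> vectors \<open>(1, x)\<close>.\<close>

lemma card_nrc_le:
  fixes N :: "('a::{field,finite} ^ 'n) set set"
  assumes "nrc r N"
  shows "card N \<le> CARD('a) + 1"
proof -
  obtain e where e: "frame r e" "N = curve r e" using assms(1) unfolding nrc_def by blast
  have "curve_pt r e u \<in> insert (curve_pt r e (vector [0, 1])) (range (\<lambda>x. curve_pt r e (vector [1, x])))"
    if "u \<noteq> 0" for u
  proof -
    define w where "w u = (\<Sum>i\<le>r. ((u $ 1) ^ (r - i) * (u $ 2) ^ i) *s e i)" for u :: "'a ^ 2"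
    have pt: "curve_pt r e u = vec.span {w u}" for u by (simp add: curve_pt_def w_def)
    have "vform r w" unfolding vform_iff w_def by blast
    then have scale: "curve_pt r e (k *s u) = curve_pt r e u" if "k \<noteq> 0" for k u
      using that by (simp add: pt vform_scale span_singleton_scale)
    show ?thesis
    proof (cases "u $ 1 = 0")
      case True
      then have "u $ 2 \<noteq> 0" and u: "u = u $ 2 *s vector [0, 1]"
        using \<open>u \<noteq> 0\<close> by (auto simp: vec_eq_iff forall_2)
      then have "curve_pt r e u = curve_pt r e (vector [0, 1])" by (subst u) (rule scale)
      then show ?thesis by blast
    next
      case False
      then have u: "u = u $ 1 *s vector [1, u $ 2 / u $ 1]" by (simp add: vec_eq_iff forall_2)
      have "curve_pt r e u = curve_pt r e (vector [1, u $ 2 / u $ 1])"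
        by (subst u) (rule scale[OF False])
      then show ?thesis by blast
    qed
  qed
  then have "N \<subseteq> insert (curve_pt r e (vector [0, 1])) (range (\<lambda>x. curve_pt r e (vector [1, x])))"
    by (auto simp: e(2) curve_def)
  then have "card N \<le> card (insert (curve_pt r e (vector [0, 1])) (range (\<lambda>x. curve_pt r e (vector [1, x]))))"
    by (intro card_mono) auto
  also have "\<dots> \<le> Suc (card (range (\<lambda>x. curve_pt r e (vector [1, x]))))" by (rule card_insert_le_m1) simp_all
  also have "\<dots> \<le> Suc CARD('a)" using card_image_le[OF finite[of "UNIV :: 'a set"]] by simp
  finally show ?thesis by simp
qed

section \<open>Coordinates with respect to a frame\<close>

text \<open>Provides the \<open>j\<close>-th coordinate function of the frame, extended so that it
  also kills a complementary subspace \<open>W\<close>. With \<open>W = {0}\<close> it compares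
  coefficients; with a 3-space missing the conic plane it projects onto that plane.\<close>

lemma frame_dual:
  assumes "frame r e" "vec.subspace W" "W \<inter> vec.span (e ` {..r}) = {0}" "j \<le> r"
  obtains h where "lfun h" "\<forall>y\<in>W. h y = 0" "\<forall>i\<le>r. h (e i) = (if i = j then 1 else 0)"
proof -
  let ?E = "e ` ({..r} - {j})"
  have E: "e ` {..r} - {e j} = ?E" using assms(1,4) by (auto simp: frame_def inj_on_def)
  have sub: "vec.span ?E \<subseteq> vec.span (e ` {..r})" by (intro vec.span_mono) auto
  have "e j \<notin> vec.span (W \<union> ?E)"
  proof
    assume "e j \<in> vec.span (W \<union> ?E)"
    then obtain a b where ab: "e j = a + b" "a \<in> W" "b \<in> vec.span ?E"
      using assms(2) by (auto simp: vec.span_Un vec.span_eq_iff[THEN iffD2])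
    have "e j \<in> vec.span (e ` {..r})" using assms(4) by (intro vec.span_base) simp
    then have "e j - b \<in> vec.span (e ` {..r})" using ab(3) sub by (intro vec.span_diff) auto
    then have "a \<in> vec.span (e ` {..r})" by (simp add: ab(1))
    then have "a = 0" using ab(2) assms(3) by blast
    then have "e j \<in> vec.span (e ` {..r} - {e j})" using ab E by simp
    moreover have "e j \<in> e ` {..r}" using assms(4) by simp
    ultimately show False using assms(1) unfolding frame_def vec.dependent_def by blast
  qed
  then obtain h where h: "lfun h" "\<forall>y\<in>vec.span (W \<union> ?E). h y = 0" "h (e j) = 1"
    by (rule lfun_separating[OF vec.subspace_span])
  show ?thesis
  proof (rule that[OF h(1)])
    show "\<forall>y\<in>W. h y = 0" using h(2) by (auto intro: vec.span_base)
    show "\<forall>i\<le>r. h (e i) = (if i = j then 1 else 0)" using h(2,3) by (auto intro: vec.span_base)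
  qed
qed

lemma frame_coeffs:
  assumes "frame r e" "(\<Sum>i\<le>r. a i *s e i) = (\<Sum>i\<le>r. b i *s e i)" "j \<le> r"
  shows "a j = b j"
proof -
  obtain h where h: "lfun h" "\<forall>y\<in>{0}. h y = 0" "\<forall>i\<le>r. h (e i) = (if i = j then 1 else 0)"
    by (rule frame_dual[OF assms(1) _ _ assms(3), of "{0}"])
      (auto simp: vec.subspace_def vec.span_zero)
  have "h (\<Sum>i\<le>r. x i *s e i) = x j" for x
  proof -
    have "h (\<Sum>i\<le>r. x i *s e i) = (\<Sum>i\<le>r. if i = j then x i else 0)"
      unfolding lfun_sum[OF h(1)] lfun_scale[OF h(1)] using h(3) by (intro sum.cong) auto
    then show ?thesis using assms(3) by simp
  qed
  then show ?thesis by (metis assms(2))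
qed

lemma curve_vector_nonzero:
  fixes u :: "'a::field ^ 2"
  assumes "frame r e" "u \<noteq> 0"
  shows "(\<Sum>i\<le>r. ((u $ 1) ^ (r - i) * (u $ 2) ^ i) *s e i) \<noteq> 0"
proof
  assume "(\<Sum>i\<le>r. ((u $ 1) ^ (r - i) * (u $ 2) ^ i) *s e i) = 0"
  then have "(\<Sum>i\<le>r. ((u $ 1) ^ (r - i) * (u $ 2) ^ i) *s e i) = (\<Sum>i\<le>r. 0 *s e i)" by simp
  from frame_coeffs[OF assms(1) this, of 0] frame_coeffs[OF assms(1) this, of r]
  have "u $ 1 = 0" "u $ 2 = 0" by auto
  with assms(2) show False by (auto simp: vec_eq_iff forall_2)
qed

text \<open>The first two coordinates are \<open>u $ 1\<close> and \<open>u $ 2\<close> times the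
  same power of \<open>u $ 1\<close>, so they determine the ratio unless \<open>u $ 1\<close>
  vanishes; the last coordinate settles that case.\<close>

lemma curve_param_unique:
  fixes u v :: "'a::field ^ 2"
  assumes "frame r e" "1 \<le> r" "u \<noteq> 0" "v \<noteq> 0"
    and eq: "(\<Sum>i\<le>r. ((v $ 1) ^ (r - i) * (v $ 2) ^ i) *s e i) =
      k *s (\<Sum>i\<le>r. ((u $ 1) ^ (r - i) * (u $ 2) ^ i) *s e i)"
  obtains l where "v = l *s u"
proof -
  have co: "(v $ 1) ^ (r - i) * (v $ 2) ^ i = k * ((u $ 1) ^ (r - i) * (u $ 2) ^ i)" if "i \<le> r" for i
    by (rule frame_coeffs[OF assms(1) _ that]) (simp add: eq vec.scale_sum_right)
  obtain s where s: "r = Suc s" using assms(2) by (cases r) auto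
  have "u $ 1 * v $ 2 = u $ 2 * v $ 1"
  proof (cases "v $ 1 = 0")
    case True
    then have "v $ 2 \<noteq> 0" using assms(4) by (auto simp: vec_eq_iff forall_2)
    with co[of r] have "k \<noteq> 0" by auto
    with co[of 0] True s have "u $ 1 = 0" by auto
    with True show ?thesis by simp
  next
    case False
    from co[of 0] co[of 1] s have *: "(v $ 1) ^ Suc s = k * (u $ 1) ^ Suc s"
      "(v $ 1) ^ s * v $ 2 = k * ((u $ 1) ^ s * u $ 2)" by simp_all
    have "(v $ 1) ^ s * (u $ 1 * v $ 2) = u $ 1 * ((v $ 1) ^ s * v $ 2)" by simp
    also have "\<dots> = u $ 2 * (k * (u $ 1) ^ Suc s)" by (simp add: *(2))
    also have "\<dots> = (v $ 1) ^ s * (u $ 2 * v $ 1)" unfolding *(1)[symmetric] by simp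
    finally show ?thesis using False by simp
  qed
  then show ?thesis using proportional_if_det_0[OF assms(3)] that by metis
qed

section \<open>Coprime pairs of a quadratic and a cubic form\<close>

text \<open>A non-constant common factor of \<open>h2\<close> and \<open>h3\<close> is linear or, up
  to a scalar, \<open>h2\<close> itself; \<open>no_root\<close> and \<open>no_div\<close> exclude
  these, so the pair is coprime and \<open>h2\<close> should divide \<open>g2\<close>, which has the
  same degree. The argument replaces greatest common divisors by linear factors split off at known
  roots.\<close>

lemma coprime_forms_proportional:
  fixes h2 h3 g2 g3 :: "'a::{field,finite} ^ 2 \<Rightarrow> 'a"
  assumes q: "CARD('a) \<ge> 6"
    and forms: "form 2 h2" "form 3 h3" "form 2 g2" "form 3 g3"
    and v: "v \<noteq> 0" "h2 v \<noteq> 0"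
    and no_root: "\<And>u. u \<noteq> 0 \<Longrightarrow> h2 u = 0 \<Longrightarrow> h3 u \<noteq> 0"
    and no_div: "\<And>m. form 1 m \<Longrightarrow> \<exists>u. h3 u \<noteq> m u * h2 u"
    and eq: "\<And>u. u \<noteq> 0 \<Longrightarrow> h3 u * g2 u = h2 u * g3 u"
  shows "\<exists>k. \<forall>u. g2 u = k * h2 u \<and> g3 u = k * h3 u"
proof -
  \<comment> \<open>This \<open>k\<close> is the only possible one. Subtracting \<open>k\<close>
    times \<open>(h2, h3)\<close> makes both differences vanish at \<open>v\<close>, so that a
    linear factor can be split off both.\<close>
  define k where "k = g2 v / h2 v"
  define G2 G3 where "G2 u = g2 u - k * h2 u" and "G3 u = g3 u - k * h3 u" for u
  let ?l = "\<lambda>w u :: 'a ^ 2. w $ 1 * u $ 2 - w $ 2 * u $ 1"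
  have form_l: "form 1 (?l w)" for w
    by (intro form_diff form_cmult form_fst form_snd)
  have l_nz: "\<exists>u. ?l w u \<noteq> 0" if "w \<noteq> 0" for w :: "'a ^ 2"
  proof (cases "w $ 1 = 0")
    case True
    then have "?l w (vector [1, 0]) \<noteq> 0" using that by (auto simp: vec_eq_iff forall_2)
    then show ?thesis by blast
  next
    case False
    then have "?l w (vector [0, 1]) \<noteq> 0" by simp
    then show ?thesis by blast
  qed
  have fG: "form (Suc 1) G2" "form (Suc 2) G3" unfolding G2_def G3_def
    using forms by (auto intro!: form_diff form_cmult simp: numeral_2_eq_2 numeral_3_eq_3)
  have eqG: "h3 u * G2 u = h2 u * G3 u" if "u \<noteq> 0" for u
    using eq[OF that] by (simp add: G2_def G3_def algebra_simps)
  have "G2 v = 0" using v by (simp add: G2_def k_def)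
  with eqG[OF v(1)] v have "G3 v = 0" by simp
  obtain A where A: "form 1 A" "\<And>u. G2 u = ?l v u * A u"
    using form_factor[OF fG(1) v(1) \<open>G2 v = 0\<close>] by blast
  obtain Q where Q: "form 2 Q" "\<And>u. G3 u = ?l v u * Q u"
    using form_factor[OF fG(2) v(1) \<open>G3 v = 0\<close>] by blast
  obtain v' where v': "?l v v' \<noteq> 0" using l_nz[OF v(1)] by blast
  have eqA: "h3 u * A u = h2 u * Q u" for u
  proof -
    \<comment> \<open>Cancelling a linear form from an identity of degree 4 involves total degree 5,
      for which \<open>CARD('a) \<ge> 6\<close> just suffices.\<close>
    have "h3 u * A u - h2 u * Q u = 0"
    proof (rule form_eq_0_if_nonzero[where p = "\<lambda>u. h3 u * A u - h2 u * Q u" and r = 4 and s = 1,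
          OF _ form_l[of v] _ _ v'])
      show "form 4 (\<lambda>u. h3 u * A u - h2 u * Q u)"
        using form_diff[OF form_mult[OF forms(2) A(1)]] form_mult[OF forms(1) Q(1)] by simp
      show "h3 u * A u - h2 u * Q u = 0" if "u \<noteq> 0" "?l v u \<noteq> 0" for u
        using eqG[OF that(1)] that(2) by (simp add: A Q mult.left_commute)
    qed (use q in simp)
    then show ?thesis by simp
  qed
  show ?thesis
  proof (cases "\<forall>u. A u = 0")
    case True
    with eqA have "h2 u * Q u = 0" for u by simp
    then have "Q u = 0" for u
      using form_no_zero_divisors[OF forms(1) Q(1)] q v by auto
    with True A Q have "G2 u = 0" "G3 u = 0" for u by auto
    then show ?thesis unfolding G2_def G3_def by (intro exI[of _ k]) simp
  next
    case False
    \<comment> \<open>A non-zero \<open>A\<close> has a root \<open>w\<close>, and there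
      \<open>h2\<close> or \<open>Q\<close> vanishes. Cancelling the factor of \<open>w\<close> then
      makes either \<open>h2\<close> divide \<open>h3\<close>, or the cofactor \<open>m\<close> of
      \<open>h2\<close> divide \<open>h3\<close>; in the latter case the root of \<open>m\<close> is
      a common root.\<close>
    obtain w where w: "w \<noteq> 0" "A w = 0" using linear_form_root[OF A(1)] by blast
    obtain A' where A': "form 0 A'" "\<And>u. A u = ?l w u * A' u"
      using form_factor[of 0 A w] A(1) w by auto
    obtain a where a: "\<forall>u. A' u = a" by (rule formE[OF A'(1)]) auto
    have "a \<noteq> 0" using False A'(2) a by auto
    obtain w' where w': "?l w w' \<noteq> 0" using l_nz[OF w(1)] by blast
    have "h2 w = 0 \<or> Q w = 0" using eqA[of w] w by simp
    then show ?thesis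
    proof
      assume "Q w = 0"
      then obtain Q' where Q': "form 1 Q'" "\<And>u. Q u = ?l w u * Q' u"
        using form_factor[of 1 Q w] Q(1) w by (auto simp: numeral_2_eq_2)
      have "a * h3 u - h2 u * Q' u = 0" for u
      proof (rule form_eq_0_if_nonzero[where p = "\<lambda>u. a * h3 u - h2 u * Q' u" and r = 3 and s = 1,
            OF _ form_l[of w] _ _ w'])
        show "form 3 (\<lambda>u. a * h3 u - h2 u * Q' u)"
          using form_diff[OF form_cmult[OF forms(2)]] form_mult[OF forms(1) Q'(1)] by simp
        show "a * h3 u - h2 u * Q' u = 0" if "u \<noteq> 0" "?l w u \<noteq> 0" for u
          using eqA[of u] that(2) by (simp add: A' Q' a mult.left_commute mult.commute[of a])
      qed (use q in simp)
      then have "h3 u = (1 / a * Q' u) * h2 u" for u using \<open>a \<noteq> 0\<close> by (simp add: field_simps)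
      then show ?thesis using no_div[OF form_cmult[OF Q'(1)]] by blast
    next
      assume "h2 w = 0"
      then obtain m where m: "form 1 m" "\<And>u. h2 u = ?l w u * m u"
        using form_factor[of 1 h2 w] forms(1) w by (auto simp: numeral_2_eq_2)
      have *: "a * h3 u - m u * Q u = 0" for u
      proof (rule form_eq_0_if_nonzero[where p = "\<lambda>u. a * h3 u - m u * Q u" and r = 3 and s = 1,
            OF _ form_l[of w] _ _ w'])
        show "form 3 (\<lambda>u. a * h3 u - m u * Q u)"
          using form_diff[OF form_cmult[OF forms(2)]] form_mult[OF m(1) Q(1)]
          by (simp add: numeral_3_eq_3)
        show "a * h3 u - m u * Q u = 0" if "u \<noteq> 0" "?l w u \<noteq> 0" for u
          using eqA[of u] that(2) by (simp add: A' m a mult_ac)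
      qed (use q in simp)
      obtain z where "z \<noteq> 0" "m z = 0" using linear_form_root[OF m(1)] by blast
      with *[of z] m(2)[of z] no_root[of z] \<open>a \<noteq> 0\<close> show ?thesis by simp
    qed
  qed
qed

section \<open>Hyperplane sections of the ruled quintic surface\<close>

text \<open>The projectivity does not occur here: it is absorbed into the frame \<open>f\<close> by
  \<open>curve_reparametrise\<close>, so both directrices use the same parameter
  \<open>u\<close>.\<close>

locale quintic =
  fixes e f :: "nat \<Rightarrow> 'a::{field,finite} ^ 7"
  assumes q: "CARD('a) \<ge> 6"
    and frame_e: "frame 2 e" and frame_f: "frame 3 f"
    and disjoint: "vec.span (e ` {..2}) \<inter> vec.span (f ` {..3}) = {0}"
begin

definition c :: "'a ^ 2 \<Rightarrow> 'a ^ 7"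
  where "c u = (\<Sum>i\<le>2. ((u $ 1) ^ (2 - i) * (u $ 2) ^ i) *s e i)"

definition n :: "'a ^ 2 \<Rightarrow> 'a ^ 7"
  where "n u = (\<Sum>i\<le>3. ((u $ 1) ^ (3 - i) * (u $ 2) ^ i) *s f i)"

definition gen :: "'a ^ 2 \<Rightarrow> ('a ^ 7) set"
  where "gen u = vec.span {c u, n u}"

definition surface :: "('a ^ 7) set set"
  where "surface = (\<Union>u\<in>{u. u \<noteq> 0}. pts (gen u))"

abbreviation E where "E \<equiv> vec.span (e ` {..2})"

lemma vform_c: "vform 2 c" unfolding vform_iff c_def by blast
lemma vform_n: "vform 3 n" unfolding vform_iff n_def by blast

lemma form_c: "lfun h \<Longrightarrow> form 2 (\<lambda>u. h (c u))" using form_lfun_vform[OF _ vform_c] .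
lemma form_n: "lfun h \<Longrightarrow> form 3 (\<lambda>u. h (n u))" using form_lfun_vform[OF _ vform_n] .

lemma span_c: "vec.span {c u | u. u \<noteq> 0} = E"
  by (rule span_vform[OF c_def]) (use q in simp)

lemma span_n: "vec.span {n u | u. u \<noteq> 0} = vec.span (f ` {..3})"
  by (rule span_vform[OF n_def]) (use q in simp)

lemma c_in: "c u \<in> E"
  unfolding c_def by (intro vec.span_sum vec.span_scale vec.span_base) auto

lemma n_in: "n u \<in> vec.span (f ` {..3})"
  unfolding n_def by (intro vec.span_sum vec.span_scale vec.span_base) auto

lemma dim_E: "vec.dim E = 3" using dim_frame[OF frame_e] by simp

lemma c_unique: "u \<noteq> 0 \<Longrightarrow> v \<noteq> 0 \<Longrightarrow> c v = k *s c u \<Longrightarrow> \<exists>l. v = l *s u"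
  using curve_param_unique[OF frame_e, of u v k] unfolding c_def by fastforce

lemma n_unique: "u \<noteq> 0 \<Longrightarrow> v \<noteq> 0 \<Longrightarrow> n v = k *s n u \<Longrightarrow> \<exists>l. v = l *s u"
  using curve_param_unique[OF frame_f, of u v k] unfolding n_def by fastforce

lemma c_scale: "c (k *s u) = k ^ 2 *s c u" and n_scale: "n (k *s u) = k ^ 3 *s n u"
  using vform_scale[OF vform_c] vform_scale[OF vform_n] by simp_all

lemma c_nz: "u \<noteq> 0 \<Longrightarrow> c u \<noteq> 0"
  unfolding c_def by (rule curve_vector_nonzero[OF frame_e])

lemma n_nz: "u \<noteq> 0 \<Longrightarrow> n u \<noteq> 0"
  unfolding n_def by (rule curve_vector_nonzero[OF frame_f])

lemma n_comb_E:
  assumes "t *s n u - t' *s n v \<in> E"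
  shows "t *s n u = t' *s n v"
proof -
  have "t *s n u - t' *s n v \<in> vec.span (f ` {..3})"
    by (intro vec.span_diff vec.span_scale n_in)
  with assms disjoint have "t *s n u - t' *s n v = 0" by blast
  then show ?thesis by simp
qed

lemma n_notin_E: "u \<noteq> 0 \<Longrightarrow> n u \<notin> E"
  using n_comb_E[of 1 u 0 u] n_nz[of u] by auto

lemma comb_in_E: 
  assumes "u \<noteq> 0" "s *s c u + t *s n u \<in> E"
  shows "t = 0"
proof (rule ccontr)
  assume "t \<noteq> 0"
  have "(s *s c u + t *s n u) - s *s c u \<in> E"
    using assms(2) c_in by (intro vec.span_diff vec.span_scale)
  then have "t *s n u \<in> E" by simp
  then have "(1 / t) *s (t *s n u) \<in> E" by (rule vec.span_scale)
  then show False using n_notin_E[OF assms(1)] \<open>t \<noteq> 0\<close> by simp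
qed

lemma comb_nz: "u \<noteq> 0 \<Longrightarrow> s \<noteq> 0 \<or> t \<noteq> 0 \<Longrightarrow> s *s c u + t *s n u \<noteq> 0"
  using comb_in_E[of u s t] c_nz[of u] by (metis add.right_neutral vec.scale_eq_0_iff vec.span_zero)

text \<open>Lets generators be counted by conic points. A generator meets the conic plane only in
  \<open>c u\<close>, so equal generators have the same conic point, and this determines the
  parameter up to a scalar.\<close>

lemma gen_eq_iff:
  assumes u: "u \<noteq> 0" and v: "v \<noteq> 0"
  shows "gen u = gen v \<longleftrightarrow> (\<exists>k. k \<noteq> 0 \<and> v = k *s u)"
proof
  assume "gen u = gen v"
  then have "c v \<in> gen u" by (simp add: gen_def vec.span_base)
  then obtain s where "c v - s *s c u \<in> vec.span {n u}"
    unfolding gen_def vec.span_breakdown_eq[of "c v"] by blast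
  then obtain t where "c v - s *s c u = t *s n u" by (auto simp: vec.span_singleton)
  then have cv: "c v = s *s c u + t *s n u" by (simp add: algebra_simps)
  then have "t = 0" using comb_in_E[OF u] c_in by metis
  with cv have "c v = s *s c u" by simp
  from c_unique[OF u v this] v show "\<exists>k. k \<noteq> 0 \<and> v = k *s u" by auto
next
  assume "\<exists>k. k \<noteq> 0 \<and> v = k *s u"
  then obtain k where k: "k \<noteq> 0" "v = k *s u" by blast
  then have "c u = (1 / k ^ 2) *s c v" "n u = (1 / k ^ 3) *s n v" by (simp_all add: c_scale n_scale)
  then have "{c u, n u} \<subseteq> gen v" unfolding gen_def by (auto intro: vec.span_base vec.span_scale)
  moreover have "{c v, n v} \<subseteq> gen u" unfolding gen_def
    by (auto simp: k c_scale n_scale intro: vec.span_base vec.span_scale)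
  ultimately show "gen u = gen v" unfolding gen_def by (simp add: vec.span_eq)
qed

text \<open>The conic plane and the 3-space of the cubic have vector dimensions 3 and 4 and meet
  trivially, so they span the whole space.\<close>

lemma lfun_eq_0:
  assumes "lfun h" "\<And>u. u \<noteq> 0 \<Longrightarrow> h (c u) = 0" "\<And>u. u \<noteq> 0 \<Longrightarrow> h (n u) = 0"
  shows "h x = 0"
proof -
  have sub: "vec.subspace {y. h y = 0}" by (rule subspace_kernel[OF assms(1)])
  have "{c u | u. u \<noteq> 0} \<subseteq> {y. h y = 0}" "{n u | u. u \<noteq> 0} \<subseteq> {y. h y = 0}"
    using assms(2,3) by auto
  then have "vec.span {c u | u. u \<noteq> 0} \<subseteq> {y. h y = 0}"
    "vec.span {n u | u. u \<noteq> 0} \<subseteq> {y. h y = 0}"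
    by (simp_all add: vec.span_minimal sub)
  then have ker: "E \<subseteq> {y. h y = 0}" "vec.span (f ` {..3}) \<subseteq> {y. h y = 0}" 
    by (simp_all add: span_c span_n)
  have "vec.dim E + vec.dim (vec.span (f ` {..3})) \<le> vec.dim {y. h y = 0} + vec.dim (E \<inter> vec.span (f ` {..3}))"
    by (rule dim_Int_ge[OF vec.subspace_span vec.subspace_span sub ker])
  then have "7 \<le> vec.dim {y. h y = 0}"
    using dim_frame[OF frame_e] dim_frame[OF frame_f] by (simp add: disjoint vec.dim_insert)
  then show ?thesis using dim_kernel[OF assms(1), of x] by force
qed

lemma surface_iff:
  "P \<in> surface \<longleftrightarrow> (\<exists>u s t. u \<noteq> 0 \<and> (s \<noteq> 0 \<or> t \<noteq> 0) \<and> P = vec.span {s *s c u + t *s n u})"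
proof
  assume "P \<in> surface"
  then obtain u x where u: "u \<noteq> 0" and x: "x \<noteq> 0" "x \<in> gen u" "P = vec.span {x}"
    by (auto simp: surface_def gen_def pts_iff)
  from x(2) obtain s where "x - s *s c u \<in> vec.span {n u}"
    unfolding gen_def vec.span_breakdown_eq[of x] by blast
  then obtain t where "x - s *s c u = t *s n u" by (auto simp: vec.span_singleton)
  then have "x = s *s c u + t *s n u" by (simp add: algebra_simps)
  moreover from this x(1) have "s \<noteq> 0 \<or> t \<noteq> 0" by auto
  ultimately show "\<exists>u s t. u \<noteq> 0 \<and> (s \<noteq> 0 \<or> t \<noteq> 0) \<and> P = vec.span {s *s c u + t *s n u}"
    using u x(3) by blast
next
  assume "\<exists>u s t. u \<noteq> 0 \<and> (s \<noteq> 0 \<or> t \<noteq> 0) \<and> P = vec.span {s *s c u + t *s n u}"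
  then obtain u s t where u: "u \<noteq> 0" and st: "s \<noteq> 0 \<or> t \<noteq> 0" 
    and P: "P = vec.span {s *s c u + t *s n u}" by blast
  have "s *s c u + t *s n u \<in> gen u"
    unfolding gen_def by (intro vec.span_add vec.span_scale vec.span_base) auto
  then have "P \<in> pts (gen u)" using comb_nz[OF u st] by (simp add: P span_in_pts_iff gen_def)
  with u show "P \<in> surface" by (auto simp: surface_def)
qed

lemma section_iff:
  assumes "lfun h"
  shows "P \<in> pts {x. h x = 0} \<inter> surface \<longleftrightarrow>
    (\<exists>u s t. u \<noteq> 0 \<and> (s \<noteq> 0 \<or> t \<noteq> 0) \<and> s * h (c u) + t * h (n u) = 0 \<and>
      P = vec.span {s *s c u + t *s n u})" (is "?L \<longleftrightarrow> ?R")
proof -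
  have "vec.span {s *s c u + t *s n u} \<in> pts {x. h x = 0} \<longleftrightarrow> s * h (c u) + t * h (n u) = 0"
    if "u \<noteq> 0" "s \<noteq> 0 \<or> t \<noteq> 0" for u s t
    using span_in_pts_iff[OF subspace_kernel[OF assms] comb_nz[OF that]]
    by (simp add: lfun_add lfun_scale assms)
  then show ?thesis unfolding Int_iff surface_iff by blast
qed

lemma solution_proportional:
  fixes a b s t :: 'a
  assumes "a \<noteq> 0 \<or> b \<noteq> 0" "s \<noteq> 0 \<or> t \<noteq> 0" "s * a + t * b = 0"
  obtains k where "k \<noteq> 0" "s = k * b" "t = k * (- a)"
proof (cases "b = 0")
  case True
  with assms have "s = 0" "a \<noteq> 0" by auto
  with True assms(2) that[of "- t / a"] show ?thesis by simp
next
  case False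
  with assms(3) have "t = (s / b) * (- a)" by (simp add: field_simps eq_neg_iff_add_eq_0)
  moreover from this assms(2) have "s \<noteq> 0" by auto
  ultimately show ?thesis using False that[of "s / b"] by simp
qed

section \<open>Possible shapes of a hyperplane section\<close>

text \<open>The factor \<open>d\<close> is what is cancelled from
  \<open>(h \<circ> c, h \<circ> n)\<close>. Off its zeros the generator is met in the single point
  \<open>(b : - a)\<close>; at its zeros the whole generator is contained, and the curve still has a
  point there by \<open>nz\<close>. The choices of \<open>d\<close> below are 1,
  \<open>h \<circ> c\<close> and a linear form.\<close>

lemma section_eq_curve:
  assumes "lfun h" 
    and nz: "\<And>u. u \<noteq> 0 \<Longrightarrow> a u \<noteq> 0 \<or> b u \<noteq> 0"
    and h: "\<And>u. u \<noteq> 0 \<Longrightarrow> h (c u) = d u * a u" "\<And>u. u \<noteq> 0 \<Longrightarrow> h (n u) = d u * b u"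
  shows "pts {x. h x = 0} \<inter> surface =
    {vec.span {b u *s c u - a u *s n u} | u. u \<noteq> 0} \<union> (\<Union>u\<in>{u. u \<noteq> 0 \<and> d u = 0}. pts (gen u))"
    (is "?L = ?N \<union> ?K")
proof (intro equalityI subsetI)
  fix P assume "P \<in> ?L"
  then obtain u s t where u: "u \<noteq> 0" and st: "s \<noteq> 0 \<or> t \<noteq> 0"
    and eq: "s * h (c u) + t * h (n u) = 0" and P: "P = vec.span {s *s c u + t *s n u}"
    unfolding section_iff[OF assms(1)] by blast
  show "P \<in> ?N \<union> ?K"
  proof (cases "d u = 0")
    case True
    have "s *s c u + t *s n u \<in> gen u"
      unfolding gen_def by (intro vec.span_add vec.span_scale vec.span_base) auto
    then have "P \<in> pts (gen u)" using comb_nz[OF u st] by (simp add: P span_in_pts_iff gen_def)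
    with u True show ?thesis by blast
  next
    case False
    have "d u * (s * a u + t * b u) = 0" using eq by (simp add: h[OF u] algebra_simps)
    with False have "s * a u + t * b u = 0" by simp
    then obtain k where k: "k \<noteq> 0" "s = k * b u" "t = k * (- a u)"
      using solution_proportional[OF nz[OF u] st] by blast
    have "s *s c u + t *s n u = k *s (b u *s c u - a u *s n u)"
      by (simp add: k vec_eq_iff algebra_simps)
    then have "P = vec.span {b u *s c u - a u *s n u}" using k(1) by (simp add: P span_singleton_scale)
    with u show ?thesis by blast
  qed
next
  fix P assume "P \<in> ?N \<union> ?K"
  then show "P \<in> ?L"
  proof
    assume "P \<in> ?N"
    then obtain u where u: "u \<noteq> 0" "P = vec.span {b u *s c u - a u *s n u}" by blast
    then have "P = vec.span {b u *s c u + (- a u) *s n u}" by simp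
    moreover have "b u * h (c u) + (- a u) * h (n u) = 0" by (simp add: h[OF u(1)])
    moreover have "b u \<noteq> 0 \<or> - a u \<noteq> 0" using nz[OF u(1)] by auto
    ultimately show ?thesis using u(1) unfolding section_iff[OF assms(1)] by blast
  next
    assume "P \<in> ?K"
    then obtain u where u: "u \<noteq> 0" "d u = 0" "P \<in> pts (gen u)" by blast
    then have "{c u, n u} \<subseteq> {x. h x = 0}" using h by simp
    then have "gen u \<subseteq> {x. h x = 0}"
      unfolding gen_def by (rule vec.span_minimal[OF _ subspace_kernel[OF assms(1)]])
    with u show ?thesis by (auto simp: pts_def surface_def)
  qed
qed

text \<open>The curve of degree 5 spans the whole hyperplane: a functional \<open>g\<close> that
  vanishes on it satisfies the cross relation of \<open>coprime_forms_proportional\<close>, hence is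
  a multiple of \<open>h\<close>.\<close>

lemma section_coprime:
  assumes h: "lfun h" and v: "v \<noteq> 0" "h (c v) \<noteq> 0"
    and no_root: "\<And>u. u \<noteq> 0 \<Longrightarrow> h (c u) = 0 \<Longrightarrow> h (n u) \<noteq> 0"
    and no_div: "\<And>m. form 1 m \<Longrightarrow> \<exists>u. h (n u) \<noteq> m u * h (c u)"
  shows "nrc 5 (pts {x. h x = 0} \<inter> surface)"
proof -
  define w where "w u = h (n u) *s c u - h (c u) *s n u" for u
  have "pts {x. h x = 0} \<inter> surface = {vec.span {w u} | u. u \<noteq> 0}"
    using section_eq_curve[OF h, of "\<lambda>u. h (c u)" "\<lambda>u. h (n u)" "\<lambda>u. 1"] no_root
    by (auto simp: w_def)
  moreover have "nrc 5 {vec.span {w u} | u. u \<noteq> 0}"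
  proof (rule nrc_if_vform)
    show "vform 5 w"
      using vform_diff[OF vform_mult[OF form_n[OF h] vform_c]] 
        vform_mult[OF form_c[OF h] vform_n] by (simp add: w_def[abs_def])
    show "5 + 1 \<le> vec.dim {w u | u. u \<noteq> 0}"
    proof (rule ccontr)
      let ?W = "vec.span {w u | u. u \<noteq> 0}" and ?H = "{x. h x = 0}"
      assume "\<not> ?thesis"
      then have "vec.dim ?W < 6" by simp
      moreover have "vec.dim ?H = 6" using dim_kernel[OF h v(2)] by simp
      ultimately have "\<not> ?H \<subseteq> ?W" using vec.dim_subset[of ?H ?W] by linarith
      then obtain x where x: "h x = 0" "x \<notin> ?W" by blast
      obtain g where g: "lfun g" "\<forall>y\<in>?W. g y = 0" "g x = 1"
        by (rule lfun_separating[OF vec.subspace_span x(2)])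
      have eq: "h (n u) * g (c u) = h (c u) * g (n u)" if "u \<noteq> 0" for u
      proof -
        have "w u \<in> ?W" using that by (intro vec.span_base) auto
        with g(2) have "g (w u) = 0" by blast
        then show ?thesis by (simp add: w_def lfun_diff lfun_scale g(1))
      qed
      obtain k where k: "\<forall>u. g (c u) = k * h (c u) \<and> g (n u) = k * h (n u)"
        using coprime_forms_proportional[OF q form_c[OF h] form_n[OF h] form_c[OF g(1)] form_n[OF g(1)]
            v no_root no_div eq] by blast
      have "g x + (- k) * h x = 0"
        by (rule lfun_eq_0[OF lfun_combine[OF g(1) h, of "- k"]]) (simp_all add: k)
      with x(1) g(3) show False by simp
    qed
  qed
  ultimately show ?thesis by simp
qed

text \<open>Projecting from \<open>E\<close> maps \<open>W\<close> onto everything: a functional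
  that kills \<open>W\<close> and \<open>E\<close> satisfies \<open>h (n u) * p u = 0\<close>, so it
  kills the twisted cubic too, as forms have no zero divisors. The bound then follows from
  \<open>vec.dim E = 3\<close> in dimension 7.\<close>

lemma dim_ge_if_projection:
  assumes "vec.subspace W" "form d p" "d + 3 < CARD('a)" "p v \<noteq> 0"
    and "\<And>u. u \<noteq> 0 \<Longrightarrow> \<exists>a\<in>E. a + p u *s n u \<in> W"
  shows "4 + vec.dim (W \<inter> E) \<le> vec.dim W"
proof -
  let ?T = "{x + y | x y. x \<in> W \<and> y \<in> E}"
  have sub: "vec.subspace ?T" using vec.subspace_sums[OF assms(1) vec.subspace_span] .
  have ET: "E \<subseteq> ?T" using vec.subspace_0[OF assms(1)] by force
  have WT: "W \<subseteq> ?T" using vec.subspace_0[OF vec.subspace_span, of "e ` {..2}"] by force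
  have "?T = UNIV"
  proof (rule ccontr)
    assume "?T \<noteq> UNIV"
    then obtain x where "x \<notin> ?T" by blast
    then obtain h where h: "lfun h" "\<forall>y\<in>?T. h y = 0" "h x = 1"
      by (rule lfun_separating[OF sub])
    have hc: "h y = 0" if "y \<in> E" for y using h(2) ET that by blast
    have prod: "h (n u) * p u = 0" if u: "u \<noteq> 0" for u
    proof -
      obtain a where a: "a \<in> E" "a + p u *s n u \<in> W" using assms(5)[OF u] by blast
      then have "h (a + p u *s n u) = 0" using h(2) WT by blast
      with hc[OF a(1)] show ?thesis by (simp add: lfun_add lfun_scale h(1) mult.commute)
    qed
    have hn: "h (n u) = 0" for u
      using form_no_zero_divisors[OF form_n[OF h(1)] assms(2) _ prod] assms(3,4) by auto
    have "h x = 0" by (rule lfun_eq_0[OF h(1) hc[OF c_in] hn])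
    with h(3) show False by simp
  qed
  then have "vec.dim ?T = 7" by (simp add: card_cart_basis)
  with vec.dim_sums_Int[OF assms(1) vec.subspace_span, of "e ` {..2}"] show ?thesis
    using dim_E by simp
qed

text \<open>With all of \<open>h \<circ> c\<close> cancelled, the curve
  \<open>m u *s c u - n u\<close> of degree 3 remains. Its projection from \<open>E\<close> is the
  twisted cubic, so it spans at least a 3-space.\<close>

lemma section_divides:
  assumes h: "lfun h" and m: "form 1 m" "\<And>u. h (n u) = m u * h (c u)"
  obtains N where "nrc 3 N"
    "pts {x. h x = 0} \<inter> surface = N \<union> (\<Union>u\<in>{u. u \<noteq> 0 \<and> h (c u) = 0}. pts (gen u))"
proof -
  define w where "w u = m u *s c u - n u" for u
  have "pts {x. h x = 0} \<inter> surface = {vec.span {w u} | u. u \<noteq> 0} \<union> 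
      (\<Union>u\<in>{u. u \<noteq> 0 \<and> h (c u) = 0}. pts (gen u))"
    using section_eq_curve[OF h, of "\<lambda>u. 1" m "\<lambda>u. h (c u)"] m(2)
    by (simp add: w_def mult.commute)
  moreover have "nrc 3 {vec.span {w u} | u. u \<noteq> 0}"
  proof (rule nrc_if_vform)
    show "vform 3 w"
      unfolding w_def[abs_def] using vform_mult[OF m(1) vform_c]
      by (intro vform_diff vform_n) (simp add: numeral_3_eq_3)
    let ?W = "vec.span {w u | u. u \<noteq> 0}"
    have "4 + vec.dim (?W \<inter> E) \<le> vec.dim ?W"
    proof (rule dim_ge_if_projection[OF vec.subspace_span form_0[of "-1"]])
      fix u :: "'a ^ 2" assume "u \<noteq> 0"
      then have "m u *s c u + (-1) *s n u \<in> ?W" by (intro vec.span_base) (auto simp: w_def)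
      then show "\<exists>a\<in>E. a + (-1) *s n u \<in> ?W" using vec.span_scale[OF c_in] by blast
    qed (use q in auto)
    then show "3 + 1 \<le> vec.dim {w u | u. u \<noteq> 0}" by simp
  qed
  ultimately show ?thesis using that by blast
qed

text \<open>Only the linear factor of \<open>r\<close> is common. The remaining curve has degree 4;
  projecting from \<open>E\<close> accounts for four dimensions, and its point in \<open>E\<close>
  supplies the fifth.\<close>

lemma section_common_root:
  assumes h: "lfun h" and v: "h (c v) \<noteq> 0"
    and r: "r \<noteq> 0" "h (c r) = 0" "h (n r) = 0"
    and no_div: "\<And>m. form 1 m \<Longrightarrow> \<exists>u. h (n u) \<noteq> m u * h (c u)"
  obtains N where "nrc 4 N" "pts {x. h x = 0} \<inter> surface = N \<union> pts (gen r)"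
proof -
  let ?l = "\<lambda>w u :: 'a ^ 2. w $ 1 * u $ 2 - w $ 2 * u $ 1"
  obtain a where a: "form 1 a" "\<And>u. h (c u) = ?l r u * a u"
    using form_factor[of 1 "\<lambda>u. h (c u)" r] form_c[OF h] r by (auto simp: numeral_2_eq_2)
  obtain b where b: "form 2 b" "\<And>u. h (n u) = ?l r u * b u"
    using form_factor[of 2 "\<lambda>u. h (n u)" r] form_n[OF h] r by (auto simp: numeral_3_eq_3)
  have "a v \<noteq> 0" using v a(2) by auto
  \<comment> \<open>At a second common root the cofactor \<open>a\<close> would be a scalar multiple
    of the linear form that also divides \<open>b\<close>, so \<open>h \<circ> c\<close> would
    divide \<open>h \<circ> n\<close>.\<close>
  have nz: "a u \<noteq> 0 \<or> b u \<noteq> 0" if u: "u \<noteq> 0" for u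
  proof (rule ccontr)
    assume "\<not> (a u \<noteq> 0 \<or> b u \<noteq> 0)"
    then have ab: "a u = 0" "b u = 0" by auto
    obtain a' where a': "form 0 a'" "\<And>x. a x = ?l u x * a' x"
      using form_factor[of 0 a u] a(1) u ab by auto
    obtain k where k: "\<forall>x. a' x = k" by (rule formE[OF a'(1)]) auto
    obtain m where m: "form 1 m" "\<And>x. b x = ?l u x * m x"
      using form_factor[of 1 b u] b(1) u ab by (auto simp: numeral_2_eq_2)
    have "k \<noteq> 0" using \<open>a v \<noteq> 0\<close> a' k by auto
    then have "h (n x) = (1 / k * m x) * h (c x)" for x
      by (simp add: a b a' m k)
    then show False using no_div[OF form_cmult[OF m(1)]] by blast
  qed
  define w where "w u = b u *s c u - a u *s n u" for u
  have gen_r: "gen u = gen r" if "u \<noteq> 0" "?l r u = 0" for u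
  proof -
    have "r $ 1 * u $ 2 = r $ 2 * u $ 1" using that(2) by simp
    then obtain k where k: "u = k *s r" using proportional_if_det_0[OF r(1)] by metis
    with that(1) have "k \<noteq> 0" by auto
    with k show ?thesis using gen_eq_iff[OF r(1) that(1)] by auto
  qed
  have "(\<Union>u\<in>{u. u \<noteq> 0 \<and> ?l r u = 0}. pts (gen u)) = pts (gen r)"
  proof (intro equalityI UN_least)
    fix u assume "u \<in> {u. u \<noteq> 0 \<and> ?l r u = 0}"
    then have "gen u = gen r" by (intro gen_r) auto
    then show "pts (gen u) \<subseteq> pts (gen r)" by simp
  next
    show "pts (gen r) \<subseteq> (\<Union>u\<in>{u. u \<noteq> 0 \<and> ?l r u = 0}. pts (gen u))"
      by (rule UN_upper) (simp add: r)
  qed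
  then have "pts {x. h x = 0} \<inter> surface = {vec.span {w u} | u. u \<noteq> 0} \<union> pts (gen r)"
    using section_eq_curve[OF h nz a(2) b(2)] by (simp add: w_def)
  moreover have "nrc 4 {vec.span {w u} | u. u \<noteq> 0}"
  proof (rule nrc_if_vform)
    show "vform 4 w"
      using vform_diff[OF vform_mult[OF b(1) vform_c]] vform_mult[OF a(1) vform_n]
      by (simp add: w_def[abs_def])
    let ?W = "vec.span {w u | u. u \<noteq> 0}"
    have w: "w u \<in> ?W" if "u \<noteq> 0" for u using that by (intro vec.span_base) auto
    have "4 + vec.dim (?W \<inter> E) \<le> vec.dim ?W"
    proof (rule dim_ge_if_projection[OF vec.subspace_span form_uminus[OF a(1)]])
      fix u :: "'a ^ 2" assume "u \<noteq> 0"
      then have "b u *s c u + (- a u) *s n u \<in> ?W" using w[of u] by (simp add: w_def)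
      then show "\<exists>x\<in>E. x + (- a u) *s n u \<in> ?W" using vec.span_scale[OF c_in] by blast
    qed (use q \<open>a v \<noteq> 0\<close> in auto)
    moreover have "1 \<le> vec.dim (?W \<inter> E)"
    proof -
      \<comment> \<open>At the root of \<open>a\<close> the coefficient of \<open>n z\<close>
        vanishes, so the curve meets \<open>E\<close> there.\<close>
      obtain z where z: "z \<noteq> 0" "a z = 0" using linear_form_root[OF a(1)] by blast
      then have bz: "b z \<noteq> 0" using nz by blast
      have "b z *s c z \<in> ?W \<inter> E"
        using w[OF z(1)] vec.span_scale[OF c_in] by (simp add: w_def z)
      then have "vec.dim {b z *s c z} \<le> vec.dim (?W \<inter> E)" by (intro vec.dim_subset) auto
      with bz c_nz[OF z(1)] show ?thesis by (simp add: dim_singleton)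
    qed
    ultimately show "4 + 1 \<le> vec.dim {w u | u. u \<noteq> 0}" by simp
  qed
  ultimately show ?thesis using that by blast
qed

text \<open>The section contains a generator, which already has \<open>q + 1\<close> points. A
  normal rational curve has no more, so it would be this line and could not span a 5-space.\<close>

lemma not_nrc_if_common_root:
  assumes "lfun h" "r \<noteq> 0" "h (c r) = 0" "h (n r) = 0"
  shows "\<not> nrc 5 (pts {x. h x = 0} \<inter> surface)"
proof
  let ?N = "pts {x. h x = 0} \<inter> surface"
  assume nrc: "nrc 5 ?N"
  have "gen r \<subseteq> {x. h x = 0}"
    unfolding gen_def using assms by (intro vec.span_minimal subspace_kernel) auto
  then have sub: "pts (gen r) \<subseteq> ?N" using assms(2) by (auto simp: pts_def surface_def)
  have "c r \<noteq> k *s n r" for k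
  proof
    assume "c r = k *s n r"
    then have "1 *s c r + (- k) *s n r = 0" by simp
    with comb_nz[OF assms(2), of 1 "- k"] show False by simp
  qed
  then have "CARD('a) + 1 \<le> card (pts (gen r))"
    unfolding gen_def by (rule card_pts_span_ge[OF n_nz[OF assms(2)]])
  with card_nrc_le[OF nrc] have "card ?N \<le> card (pts (gen r))" by simp
  with sub have "pts (gen r) = ?N" by (intro card_seteq) auto
  then have "\<Union>?N \<subseteq> gen r" by (auto simp: pts_def)
  then have "vec.dim (\<Union>?N) \<le> vec.dim {c r, n r}" unfolding gen_def by (metis vec.dim_span vec.dim_subset)
  also have "\<dots> \<le> card {c r, n r}" by (intro vec.dim_le_card vec.span_superset) simp
  also have "\<dots> \<le> 2" by (simp add: card_insert_if)
  finally show False using dim_nrc[OF nrc] q by simp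
qed

end

section \<open>Lines of the Bruck--Bose plane and the splash\<close>

lemma subspace_Int_zero: "vec.subspace U \<Longrightarrow> vec.subspace W \<Longrightarrow> (\<And>x. x \<in> U \<Longrightarrow> x \<in> W \<Longrightarrow> x = 0) \<Longrightarrow> U \<inter> W = {0}"
  using vec.subspace_0 by blast

lemma line_through_points:
  assumes "X \<in> pts UNIV" "Y \<in> pts UNIV" "X \<noteq> Y"
  obtains m where "pspace 1 m" "X \<in> pts m" "Y \<in> pts m"
    "\<And>m'. pspace 1 m' \<Longrightarrow> X \<in> pts m' \<Longrightarrow> Y \<in> pts m' \<Longrightarrow> m' = m"
proof -
  obtain x y where x: "x \<noteq> 0" "X = vec.span {x}" and y: "y \<noteq> 0" "Y = vec.span {y}"
    using assms by (auto simp: pts_iff)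
  have "x \<notin> vec.span {y}"
  proof
    assume "x \<in> vec.span {y}"
    then obtain k where k: "x = k *s y" by (auto simp: vec.span_singleton)
    with x have "k \<noteq> 0" by auto
    with k x y assms(3) show False by (simp add: span_singleton_scale)
  qed
  then have dim: "vec.dim {x, y} = 2" using y by (simp add: vec.dim_insert dim_singleton)
  show ?thesis
  proof (rule that)
    show "pspace 1 (vec.span {x, y})" by (simp add: pspace_def dim)
    show "X \<in> pts (vec.span {x, y})" "Y \<in> pts (vec.span {x, y})"
      using x y by (simp_all add: span_in_pts_iff vec.span_base)
    fix m' assume m': "pspace 1 m'" "X \<in> pts m'" "Y \<in> pts m'"
    then have sub: "vec.subspace m'" "vec.dim m' = 2" by (auto simp: pspace_def)
    have "vec.span {x, y} \<subseteq> m'"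
      using m' x y sub by (intro vec.span_minimal) (auto simp: span_in_pts_iff)
    then show "m' = vec.span {x, y}"
      using vec.subspace_dim_equal[OF vec.subspace_span sub(1), of "{x, y}"] by (simp add: sub dim)
  qed
qed

lemma two_points_on_line:
  assumes "pspace 1 m"
  obtains X Y where "X \<in> pts m" "Y \<in> pts m" "X \<noteq> Y"
proof -
  have sub: "vec.subspace m" and dim: "vec.dim m = 2" using assms by (auto simp: pspace_def)
  obtain x where x: "x \<in> m" "x \<noteq> 0" using nonzero_if_dim_pos[of m] dim by auto
  have "\<not> m \<subseteq> vec.span {x}"
    using vec.dim_subset[of m "vec.span {x}"] dim x by (auto simp: dim_singleton)
  then obtain y where y: "y \<in> m" "y \<notin> vec.span {x}" by blast
  then have "y \<noteq> 0" using vec.span_zero by metis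
  moreover have "vec.span {x} \<noteq> vec.span {y}" using y(2) vec.span_base[of y "{y}"] by auto
  ultimately show ?thesis using that[of "vec.span {x}" "vec.span {y}"] x y sub
    by (simp add: span_in_pts_iff)
qed

section \<open>The linear form attached to a 3-space that meets all generators\<close>

context quintic
begin

text \<open>A priori \<open>s\<close> is an arbitrary function. Projecting from \<open>U\<close>
  onto the conic plane shows that \<open>s\<close> times each of the three quadratic monomials is a
  cubic form \<open>p j\<close>, and dividing by a monomial exhibits \<open>s\<close> as a linear
  form.\<close>

lemma linear_directrix_form:
  assumes U: "vec.subspace U" "U \<inter> E = {0}" and s: "\<And>u. u \<noteq> 0 \<Longrightarrow> s u *s c u + n u \<in> U"
  shows "\<exists>m. form 1 m \<and> (\<forall>u. u \<noteq> 0 \<longrightarrow> s u = m u)"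
proof -
  have "\<exists>p. form 3 p \<and> (\<forall>u. u \<noteq> 0 \<longrightarrow> s u * ((u $ 1) ^ (2 - j) * (u $ 2) ^ j) = p u)" if j: "j \<le> 2" for j
  proof -
    obtain h where h: "lfun h" "\<forall>y\<in>U. h y = 0" "\<forall>i\<le>2. h (e i) = (if i = j then 1 else 0)"
      by (rule frame_dual[OF frame_e U j])
    have hc: "h (c u) = (u $ 1) ^ (2 - j) * (u $ 2) ^ j" for u
    proof -
      have "h (c u) = (\<Sum>i\<le>2. if i = j then (u $ 1) ^ (2 - i) * (u $ 2) ^ i else 0)"
        unfolding c_def lfun_sum[OF h(1)] lfun_scale[OF h(1)] using h(3) by (intro sum.cong) auto
      then show ?thesis using j by simp
    qed
    have "s u * h (c u) = - h (n u)" if "u \<noteq> 0" for u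
      using h(2) s[OF that] by (auto simp: lfun_add lfun_scale h(1) eq_neg_iff_add_eq_0)
    then show ?thesis using form_uminus[OF form_n[OF h(1)]] by (auto simp: hc)
  qed
  then obtain p where p: "\<And>j. j \<le> 2 \<Longrightarrow> form 3 (p j)"
    "\<And>j u. j \<le> 2 \<Longrightarrow> u \<noteq> 0 \<Longrightarrow> s u * ((u $ 1) ^ (2 - j) * (u $ 2) ^ j) = p j u"
    by metis
  have u01: "vector [0, 1] \<noteq> (0 :: 'a ^ 2)" and u10: "vector [1, 0] \<noteq> (0 :: 'a ^ 2)"
    by (simp_all add: vec_eq_iff forall_2)
  \<comment> \<open>The middle monomial \<open>u $ 1 * u $ 2\<close> vanishes at both coordinate
    points, which lets both of its factors be split off \<open>p 1\<close>.\<close>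
  have p1: "p 1 (vector [0, 1]) = 0" "p 1 (vector [1, 0]) = 0"
    using p(2)[of 1 "vector [0, 1]"] p(2)[of 1 "vector [1, 0]"] u01 u10 by simp_all
  obtain b' where b': "form 2 b'" "\<And>u. p 1 u = - u $ 1 * b' u"
    using form_factor[of 2 "p 1" "vector [0, 1]"] p(1)[of 1] p1 u01 by (auto simp: numeral_3_eq_3)
  have "b' (vector [1, 0]) = 0" using b'(2)[of "vector [1, 0]"] p1 by simp
  then obtain b where b: "form 1 b" "\<And>u. b' u = u $ 2 * b u"
    using form_factor[of 1 b' "vector [1, 0]"] b'(1) u10 by (auto simp: numeral_2_eq_2)
  define m where "m u = - b u" for u
  have m: "form 1 m" unfolding m_def[abs_def] by (rule form_uminus[OF b(1)])
  have sm: "s u = m u" if "u $ 1 \<noteq> 0" "u $ 2 \<noteq> 0" for u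
  proof -
    have "u \<noteq> 0" using that by auto
    then have "s u * (u $ 1 * u $ 2) = p 1 u" using p(2)[of 1 u] by simp
    also have "\<dots> = m u * (u $ 1 * u $ 2)" unfolding b'(2) b(2) by (simp add: m_def)
    finally have "s u * (u $ 1 * u $ 2) = m u * (u $ 1 * u $ 2)" .
    with that show ?thesis by simp
  qed
  \<comment> \<open>So far \<open>s = m\<close> is known only off the coordinate points. The
    \<open>q - 1\<close> points \<open>(1, x)\<close> with \<open>x \<noteq> 0\<close> suffice to
    identify the cubic forms, and the monomials with \<open>j = 0\<close> and \<open>j = 2\<close>
    then recover \<open>s\<close> at the coordinate points.\<close>
  have pj: "p j u = m u * ((u $ 1) ^ (2 - j) * (u $ 2) ^ j)" if "j \<le> 2" for j u
  proof -
    have "p j u - m u * ((u $ 1) ^ (2 - j) * (u $ 2) ^ j) = 0"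
    proof (rule form_eq_0[where p = "\<lambda>u. p j u - m u * ((u $ 1) ^ (2 - j) * (u $ 2) ^ j)"
          and r = 3 and X = "UNIV - {0}"])
      have "form (1 + ((2 - j) + j)) (\<lambda>u. m u * ((u $ 1) ^ (2 - j) * (u $ 2) ^ j))"
        by (intro form_mult m form_power form_fst form_snd)
      then show "form 3 (\<lambda>u. p j u - m u * ((u $ 1) ^ (2 - j) * (u $ 2) ^ j))"
        using that by (intro form_diff p(1)) (simp_all add: numeral_3_eq_3)
      show "3 < card (UNIV - {0 :: 'a})" using q by (simp add: card_Diff_subset)
      fix x :: 'a assume "x \<in> UNIV - {0}"
      then have "s (vector [1, x]) = m (vector [1, x])" by (intro sm) auto
      with p(2)[OF that vector_1_neq_0, of x]
      show "p j (vector [1, x]) - m (vector [1, x]) *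
          ((vector [1, x] :: 'a ^ 2) $ 1 ^ (2 - j) * (vector [1, x] :: 'a ^ 2) $ 2 ^ j) = 0"
        by simp
    qed simp
    then show ?thesis by simp
  qed
  have "s u = m u" if u: "u \<noteq> 0" for u
  proof (cases "u $ 1 = 0")
    case True
    then have "u $ 2 \<noteq> 0" using u by (auto simp: vec_eq_iff forall_2)
    with p(2)[OF _ u, of 2] pj[of 2 u] show ?thesis by simp
  next
    case False
    with p(2)[OF _ u, of 0] pj[of 0 u] show ?thesis by simp
  qed
  with m show ?thesis by blast
qed

end

section \<open>Affine points and lines of the Bruck-Bose plane\<close>

text \<open>Here \<open>g\<close> is an equation of the hyperplane at infinity and \<open>E\<close>
  plays the role of \<alpha>. As \<open>g\<close> vanishes on \<open>E\<close> but nowhere on the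
  twisted cubic, each generator has \<open>c u\<close> as its only point at infinity.\<close>

locale positioned_quintic = quintic e f for e f :: "nat \<Rightarrow> 'a::{field,finite} ^ 7" +
  fixes \<Sigma> :: "('a ^ 7) set" and S :: "('a ^ 7) set set" and \<beta> :: "('a ^ 3) set \<Rightarrow> ('a ^ 7) set"
    and g :: "'a ^ 7 \<Rightarrow> 'a"
  assumes lfun_g: "lfun g" and \<Sigma>_eq: "\<Sigma> = {x. g x = 0}"
    and spread: "spread2 \<Sigma> S" and E_in_S: "E \<in> S"
    and g_n: "\<And>u. u \<noteq> 0 \<Longrightarrow> g (n u) \<noteq> 0"
    and embedding: "Fq_embedding \<Sigma> S \<beta>" and image: "\<beta> ` pts UNIV = (surface - pts \<Sigma>) \<union> {E}"
begin

abbreviation "bb_line U \<equiv> (pts U - pts \<Sigma>) \<union> {U \<inter> \<Sigma>}"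

abbreviation "B \<equiv> (surface - pts \<Sigma>) \<union> {E}"

lemma B_preimage:
  assumes "P \<in> B"
  obtains Z where "Z \<in> pts UNIV" "\<beta> Z = P"
proof -
  have "P \<in> \<beta> ` pts UNIV" unfolding image by (rule assms)
  with that show ?thesis by blast
qed

lemma subspace_\<Sigma>: "vec.subspace \<Sigma>" unfolding \<Sigma>_eq by (rule subspace_kernel[OF lfun_g])

lemma dim_\<Sigma>: "vec.dim \<Sigma> = 6"
  unfolding \<Sigma>_eq using dim_kernel[OF lfun_g g_n[OF vector_1_neq_0]] by simp

lemma spread_plane: "\<rho> \<in> S \<Longrightarrow> vec.subspace \<rho> \<and> vec.dim \<rho> = 3 \<and> \<rho> \<subseteq> \<Sigma>"
  using spread by (simp add: spread2_def pspace_def)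

lemma spread_disjoint: 
  assumes "\<rho> \<in> S" "\<sigma> \<in> S" "x \<in> \<rho>" "x \<in> \<sigma>" "x \<noteq> 0"
  shows "\<rho> = \<sigma>"
proof -
  have pts: "vec.span {x} \<in> pts \<rho>" "vec.span {x} \<in> pts \<sigma>" "vec.span {x} \<in> pts \<Sigma>"
    using assms spread_plane subspace_\<Sigma> by (auto simp: span_in_pts_iff)
  then have "\<exists>!\<rho>. \<rho> \<in> S \<and> vec.span {x} \<in> pts \<rho>" using spread by (simp add: spread2_def)
  with assms pts show ?thesis by blast
qed

lemma g_E: "x \<in> E \<Longrightarrow> g x = 0"
  using spread_plane[OF E_in_S] by (auto simp: \<Sigma>_eq)

lemma g_c: "g (c u) = 0" by (rule g_E[OF c_in])

lemma point_notin_S: "x \<noteq> 0 \<Longrightarrow> vec.span {x} \<notin> S"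
  using spread_plane[of "vec.span {x}"] by (auto simp: dim_singleton)

lemma spread_plane_notin_pts: "\<rho> \<in> S \<Longrightarrow> \<rho> \<notin> pts U"
  using spread_plane[of \<rho>] by (auto simp: pts_def pspace_def)

lemma bb_line_point:
  assumes "pspace 3 U" "U \<inter> \<Sigma> \<in> S" "z \<noteq> 0" "vec.span {z} \<in> bb_line U"
  shows "z \<in> U"
proof -
  have "vec.span {z} \<noteq> U \<inter> \<Sigma>" using assms(2) point_notin_S[OF assms(3)] by metis
  then have "vec.span {z} \<in> pts U" using assms(4) by blast
  then show ?thesis using assms(1,3) by (simp add: span_in_pts_iff pspace_def)
qed

lemma bb_line_affine:
  assumes "L \<in> bb_lines \<Sigma> S" "vec.span {x} \<in> L" "g x \<noteq> 0"
  obtains U where "L = bb_line U" "pspace 3 U" "U \<inter> \<Sigma> \<in> S" "x \<in> U"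
proof -
  have "x \<noteq> 0" using assms(3) lfun_0[OF lfun_g] by auto
  then have "L \<noteq> S" using assms(2) point_notin_S by blast
  then obtain U where U: "L = bb_line U" "pspace 3 U" "U \<inter> \<Sigma> \<in> S"
    using assms(1) by (auto simp: bb_lines_def)
  have "x \<in> U" by (rule bb_line_point[OF U(2,3) \<open>x \<noteq> 0\<close> assms(2)[unfolded U(1)]])
  with U that show ?thesis by blast
qed

lemma affine_decomp:
  assumes "vec.subspace U" "x \<in> U" "g x \<noteq> 0"
  shows "y \<in> U \<longleftrightarrow> y - (g y / g x) *s x \<in> U \<inter> \<Sigma>"
proof
  assume "y \<in> U"
  then have "y - (g y / g x) *s x \<in> U" 
    using assms by (intro vec.subspace_diff vec.subspace_scale)
  moreover have "g (y - (g y / g x) *s x) = 0" using assms(3) by (simp add: lfun_diff lfun_scale lfun_g)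
  ultimately show "y - (g y / g x) *s x \<in> U \<inter> \<Sigma>" by (simp add: \<Sigma>_eq)
next
  assume "y - (g y / g x) *s x \<in> U \<inter> \<Sigma>"
  then have "(y - (g y / g x) *s x) + (g y / g x) *s x \<in> U"
    using assms by (intro vec.subspace_add vec.subspace_scale) auto
  then show "y \<in> U" by simp
qed

text \<open>Combining \<open>y\<close> with the affine vector \<open>x\<close> gives a non-zero
  vector at infinity common to both spaces, so their spread planes agree; a trace and one affine
  point determine the space by \<open>affine_decomp\<close>.\<close>

lemma bb_space_unique:
  assumes U: "pspace 3 U" "U \<inter> \<Sigma> \<in> S" and U': "pspace 3 U'" "U' \<inter> \<Sigma> \<in> S"
    and x: "x \<in> U" "x \<in> U'" "g x \<noteq> 0" and y: "y \<in> U" "y \<in> U'" "y \<notin> vec.span {x}"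
  shows "U = U'"
proof -
  have sub: "vec.subspace U" "vec.subspace U'" using U(1) U'(1) by (auto simp: pspace_def)
  let ?z = "y - (g y / g x) *s x"
  have "?z \<in> U \<inter> \<Sigma>" "?z \<in> U' \<inter> \<Sigma>"
    using affine_decomp[OF sub(1) x(1,3), of y] affine_decomp[OF sub(2) x(2,3), of y] y by auto
  moreover have "?z \<noteq> 0"
  proof
    assume "?z = 0"
    then have "y = (g y / g x) *s x" by simp
    then have "y \<in> vec.span {x}" by (metis vec.span_base vec.span_scale singletonI)
    with y(3) show False by simp
  qed
  ultimately have "U \<inter> \<Sigma> = U' \<inter> \<Sigma>" using spread_disjoint U(2) U'(2) by blast
  then show ?thesis using affine_decomp[OF sub(1) x(1,3)] affine_decomp[OF sub(2) x(2,3)] by blast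
qed

text \<open>Being affine means that the coefficient of \<open>n u\<close> is non-zero. Scaling it to
  1 leaves the coefficient \<open>s\<close> to which \<open>linear_directrix_form\<close>
  applies.\<close>

lemma affine_surface_iff:
  "P \<in> surface - pts \<Sigma> \<longleftrightarrow> (\<exists>u s. u \<noteq> 0 \<and> P = vec.span {s *s c u + n u})"
proof
  assume P: "P \<in> surface - pts \<Sigma>"
  then obtain u s t where u: "u \<noteq> 0" and st: "s \<noteq> 0 \<or> t \<noteq> 0"
    and P': "P = vec.span {s *s c u + t *s n u}" using surface_iff by auto
  from P have "g (s *s c u + t *s n u) \<noteq> 0"
    using span_in_pts_iff[OF subspace_\<Sigma> comb_nz[OF u st]] by (simp add: P' \<Sigma>_eq)
  then have "t \<noteq> 0" by (auto simp: lfun_add lfun_scale lfun_g g_c)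
  then have "s *s c u + t *s n u = t *s ((s / t) *s c u + n u)" by (simp add: vec_eq_iff field_simps)
  then have "P = vec.span {(s / t) *s c u + n u}" using \<open>t \<noteq> 0\<close> by (simp add: P' span_singleton_scale)
  with u show "\<exists>u s. u \<noteq> 0 \<and> P = vec.span {s *s c u + n u}" by blast
next
  assume "\<exists>u s. u \<noteq> 0 \<and> P = vec.span {s *s c u + n u}"
  then obtain u s where u: "u \<noteq> 0" and P: "P = vec.span {s *s c u + n u}" by blast
  have "P \<in> surface" unfolding surface_iff P using u by (intro exI[of _ u] exI[of _ s] exI[of _ 1]) simp
  moreover have "g (s *s c u + n u) \<noteq> 0" using g_n[OF u] by (simp add: lfun_add lfun_scale lfun_g g_c)
  then have "P \<notin> pts \<Sigma>"
    using span_in_pts_iff[OF subspace_\<Sigma>, of "s *s c u + n u"] comb_nz[OF u, of s 1] by (simp add: P \<Sigma>_eq)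
  ultimately show "P \<in> surface - pts \<Sigma>" by blast
qed

lemma g_affine: "u \<noteq> 0 \<Longrightarrow> g (s *s c u + n u) \<noteq> 0"
  using g_n by (simp add: lfun_add lfun_scale lfun_g g_c)

lemma collinear_image:
  assumes "X \<in> pts UNIV" "Y \<in> pts UNIV" "Z \<in> pts UNIV"
  shows "(\<exists>m. pspace 1 m \<and> X \<in> pts m \<and> Y \<in> pts m \<and> Z \<in> pts m) \<longleftrightarrow>
    (\<exists>L\<in>bb_lines \<Sigma> S. \<beta> X \<in> L \<and> \<beta> Y \<in> L \<and> \<beta> Z \<in> L)"
  using embedding assms unfolding Fq_embedding_def by simp

text \<open>
  Two lines of \<open>PG(2, q)\<close> meet, so a line of the subplane that avoids \<open>\<alpha> = E\<close> meets every
  line of the subplane through \<open>\<alpha>\<close>, that is, every generator.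
\<close>

lemma secant_meets_generators:
  assumes U: "pspace 3 U" "U \<inter> \<Sigma> \<in> S" "U \<inter> \<Sigma> \<noteq> E"
    and XY: "X \<in> pts UNIV" "Y \<in> pts UNIV" "X \<noteq> Y" "\<beta> X \<in> bb_line U" "\<beta> Y \<in> bb_line U"
    and u: "u \<noteq> 0"
  obtains s where "s *s c u + n u \<in> U"
proof -
  have subU: "vec.subspace U" using U(1) by (simp add: pspace_def)
  have inj: "inj_on \<beta> (pts UNIV)" using embedding by (simp add: Fq_embedding_def)
  have E_notin: "E \<notin> bb_line U" using spread_plane_notin_pts[OF E_in_S] U(3) by auto
  have affine: "\<beta> Z \<in> surface - pts \<Sigma>" if "Z \<in> pts UNIV" "\<beta> Z \<in> bb_line U" for Z
  proof -
    have "\<beta> Z \<in> B" unfolding image[symmetric] using that(1) by (rule imageI)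
    moreover have "\<beta> Z \<noteq> E" using that(2) E_notin by metis
    ultimately show ?thesis by blast
  qed
  obtain ux sx where x: "ux \<noteq> 0" "\<beta> X = vec.span {sx *s c ux + n ux}"
    using affine[OF XY(1,4)] affine_surface_iff by blast
  obtain uy sy where y: "uy \<noteq> 0" "\<beta> Y = vec.span {sy *s c uy + n uy}"
    using affine[OF XY(2,5)] affine_surface_iff by blast
  let ?x = "sx *s c ux + n ux" and ?y = "sy *s c uy + n uy"
  have gx: "g ?x \<noteq> 0" and gy: "g ?y \<noteq> 0" using g_affine x y by auto
  then have nz: "?x \<noteq> 0" "?y \<noteq> 0" using lfun_0[OF lfun_g] by auto
  note in_U = bb_line_point[OF U(1,2)]
  have xU: "?x \<in> U" by (rule in_U[OF nz(1) XY(4)[unfolded x(2)]])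
  have yU: "?y \<in> U" by (rule in_U[OF nz(2) XY(5)[unfolded y(2)]])
  have "\<beta> X \<noteq> \<beta> Y" using inj XY by (meson inj_onD)
  have y_notin: "?y \<notin> vec.span {?x}"
  proof
    assume "?y \<in> vec.span {?x}"
    then obtain k where k: "?y = k *s ?x" by (auto simp: vec.span_singleton)
    with nz have "k \<noteq> 0" by auto
    then have "vec.span {?y} = vec.span {?x}" unfolding k by (rule span_singleton_scale)
    with x(2) y(2) \<open>\<beta> X \<noteq> \<beta> Y\<close> show False by simp
  qed
  \<comment> \<open>The generator of \<open>u\<close> corresponds to the line of the subplane
    through \<alpha> and the point of the twisted cubic on it.\<close>
  have nu: "vec.span {n u} \<in> surface - pts \<Sigma>"
    using affine_surface_iff[of "vec.span {n u}"] u by (metis add_0 vec.scale_zero_left)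
  obtain Z where Z: "Z \<in> pts UNIV" "\<beta> Z = E" using B_preimage[of E] by blast
  obtain Z' where Z': "Z' \<in> pts UNIV" "\<beta> Z' = vec.span {n u}" using B_preimage nu by blast
  have "Z \<noteq> Z'" using Z Z' E_in_S point_notin_S[OF n_nz[OF u]] by metis
  obtain m where m: "pspace 1 m" "X \<in> pts m" "Y \<in> pts m"
    using line_through_points[OF XY(1-3)] by metis
  obtain m' where m': "pspace 1 m'" "Z \<in> pts m'" "Z' \<in> pts m'"
    using line_through_points[OF Z(1) Z'(1) \<open>Z \<noteq> Z'\<close>] by metis
  have sub: "vec.subspace m" "vec.subspace m'" "vec.dim m = 2" "vec.dim m' = 2"
    using m m' by (auto simp: pspace_def)
  \<comment> \<open>In vector dimension 3, two subspaces of dimension 2 share a point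
    \<open>W\<close>; its image lies on both lines of the Bruck-Bose plane.\<close>
  have "vec.dim m + vec.dim m' \<le> vec.dim (UNIV :: ('a ^ 3) set) + vec.dim (m \<inter> m')"
    by (rule dim_Int_ge[OF sub(1,2)]) auto
  then have "0 < vec.dim (m \<inter> m')" by (simp add: sub card_cart_basis)
  then obtain w where w: "w \<in> m \<inter> m'" "w \<noteq> 0" by (rule nonzero_if_dim_pos)
  define W where "W = vec.span {w}"
  have W: "W \<in> pts UNIV" "W \<in> pts m" "W \<in> pts m'"
    using w sub by (auto simp: W_def span_in_pts_iff)
  obtain L where L: "L \<in> bb_lines \<Sigma> S" "\<beta> X \<in> L" "\<beta> Y \<in> L" "\<beta> W \<in> L"
    using collinear_image[OF XY(1,2) W(1)] m W by blast
  obtain U1 where U1: "L = bb_line U1" "pspace 3 U1" "U1 \<inter> \<Sigma> \<in> S" "?x \<in> U1"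
    by (rule bb_line_affine[OF L(1) L(2)[unfolded x(2)] gx])
  have "?y \<in> U1" by (rule bb_line_point[OF U1(2,3) nz(2) L(3)[unfolded U1(1) y(2)]])
  then have "U1 = U"
    by (rule bb_space_unique[OF U1(2,3) U(1,2) U1(4) xU gx _ yU y_notin])
  then have WU: "\<beta> W \<in> bb_line U" using L(4) U1(1) by simp
  obtain v s where v: "v \<noteq> 0" "\<beta> W = vec.span {s *s c v + n v}"
    using affine[OF W(1) WU] affine_surface_iff by blast
  let ?z = "s *s c v + n v"
  have "?z \<noteq> 0" using g_affine[OF v(1), of s] lfun_0[OF lfun_g] by auto
  then have zU: "?z \<in> U" by (rule in_U[OF _ WU[unfolded v(2)]])
  obtain L' where L': "L' \<in> bb_lines \<Sigma> S" "\<beta> Z \<in> L'" "\<beta> Z' \<in> L'" "\<beta> W \<in> L'"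
    using collinear_image[OF Z(1) Z'(1) W(1)] m' W by blast
  obtain U' where U': "L' = bb_line U'" "pspace 3 U'" "U' \<inter> \<Sigma> \<in> S" "n u \<in> U'"
    by (rule bb_line_affine[OF L'(1) L'(3)[unfolded Z'(2)] g_n[OF u]])
  have EU': "U' \<inter> \<Sigma> = E"
    using L'(2) U'(1) spread_plane_notin_pts[OF E_in_S] unfolding Z(2) by auto
  have "?z \<in> U'" by (rule bb_line_point[OF U'(2,3) \<open>?z \<noteq> 0\<close> L'(4)[unfolded U'(1) v(2)]])
  moreover have "vec.subspace U'" using U'(2) by (simp add: pspace_def)
  \<comment> \<open>As the trace of \<open>U'\<close> is \<open>E\<close>, the point
    \<open>?z\<close> agrees with a multiple of \<open>n u\<close> modulo \<open>E\<close>. Hence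
    \<open>n v\<close> is proportional to \<open>n u\<close>, and \<open>?z\<close> lies on the
    generator of \<open>u\<close>.\<close>
  ultimately have "?z - (g ?z / g (n u)) *s n u \<in> E"
    using affine_decomp[OF _ U'(4) g_n[OF u]] EU' by blast
  then have "(?z - (g ?z / g (n u)) *s n u) - s *s c v \<in> E"
    by (rule vec.span_diff) (intro vec.span_scale c_in)
  then have "1 *s n v - (g ?z / g (n u)) *s n u \<in> E" by (simp add: algebra_simps)
  from n_comb_E[OF this] obtain l where l: "v = l *s u" using n_unique[OF u v(1)] by auto
  with v(1) have "l \<noteq> 0" by auto
  \<comment> \<open>Passing from the parameter \<open>v = l *s u\<close> to \<open>u\<close> scales
    \<open>n\<close> by the cube of \<open>l\<close>; dividing by it restores the coefficient
    1.\<close>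
  have "(1 / l ^ 3) *s ?z \<in> U" using subU zU by (rule vec.subspace_scale)
  moreover have "(1 / l ^ 3) *s ?z = (s * l ^ 2 / l ^ 3) *s c u + n u"
    using \<open>l \<noteq> 0\<close> by (simp add: l c_scale n_scale vec_eq_iff field_simps)
  ultimately show ?thesis using that by metis
qed

lemma Int_E_zero:
  assumes "vec.subspace U" "U \<inter> \<Sigma> \<in> S" "U \<inter> \<Sigma> \<noteq> E"
  shows "U \<inter> E = {0}"
proof (rule subspace_Int_zero[OF assms(1) vec.subspace_span])
  fix x assume "x \<in> U" "x \<in> E"
  then have "x \<in> U \<inter> \<Sigma>" using g_E by (simp add: \<Sigma>_eq)
  with \<open>x \<in> E\<close> spread_disjoint[OF assms(2) E_in_S] assms(3) show "x = 0" by blast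
qed

lemma secant_form:
  assumes U: "pspace 3 U" "U \<inter> \<Sigma> \<in> S" "U \<inter> \<Sigma> \<noteq> E"
    and XY: "X \<in> pts UNIV" "Y \<in> pts UNIV" "X \<noteq> Y" "\<beta> X \<in> bb_line U" "\<beta> Y \<in> bb_line U"
  obtains m where "form 1 m" "\<And>u. u \<noteq> 0 \<Longrightarrow> m u *s c u + n u \<in> U"
proof -
  have sub: "vec.subspace U" using U(1) by (simp add: pspace_def)
  have "\<exists>s. s *s c u + n u \<in> U" if "u \<noteq> 0" for u
    using secant_meets_generators[OF U XY that] by metis
  then obtain s where s: "\<And>u. u \<noteq> 0 \<Longrightarrow> s u *s c u + n u \<in> U" by metis
  then obtain m where "form 1 m" "\<And>u. u \<noteq> 0 \<Longrightarrow> s u = m u"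
    using linear_directrix_form[OF sub Int_E_zero[OF sub U(2,3)]] by metis
  with s that show ?thesis by metis
qed

section \<open>Describing the splash by linear forms\<close>

text \<open>The subline provides two points of the subplane. They cannot both be at infinity, so the
  line is a 3-space, to which \<open>secant_form\<close> applies.\<close>

lemma splash_cases:
  assumes "\<rho> \<in> splash \<Sigma> S B" "\<rho> \<noteq> E"
  obtains U m where "pspace 3 U" "\<rho> = U \<inter> \<Sigma>" "form 1 m" "\<And>u. u \<noteq> 0 \<Longrightarrow> m u *s c u + n u \<in> U"
proof -
  obtain L where \<rho>: "\<rho> \<in> S" and L: "L \<in> bb_lines \<Sigma> S" "\<rho> \<in> L" "Fq_subline \<Sigma> S (L \<inter> B)"
    using assms(1) by (auto simp: splash_def)
  obtain \<beta>' m' where \<beta>': "Fq_embedding \<Sigma> S \<beta>'" "pspace 1 m'" "L \<inter> B = \<beta>' ` pts m'"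
    using L(3) unfolding Fq_subline_def by blast
  obtain X' Y' where XY': "X' \<in> pts m'" "Y' \<in> pts m'" "X' \<noteq> Y'"
    using two_points_on_line[OF \<beta>'(2)] by blast
  have "inj_on \<beta>' (pts UNIV)" using \<beta>'(1) by (simp add: Fq_embedding_def)
  moreover have "X' \<in> pts UNIV" "Y' \<in> pts UNIV" using XY' by (auto simp: pts_def)
  ultimately have ne: "\<beta>' X' \<noteq> \<beta>' Y'" using XY'(3) by (meson inj_onD)
  have LB: "\<beta>' X' \<in> L \<inter> B" "\<beta>' Y' \<in> L \<inter> B" unfolding \<beta>'(3) using XY' by blast+
  have "S \<inter> B \<subseteq> {E}" 
  proof
    fix P assume P: "P \<in> S \<inter> B"
    then have "P \<notin> pts UNIV" using spread_plane_notin_pts by blast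
    moreover have "surface \<subseteq> pts UNIV" by (auto simp: surface_def pts_def)
    ultimately show "P \<in> {E}" using P by blast
  qed
  then have "L \<noteq> S" using LB ne by blast
  then obtain U where U: "L = bb_line U" "pspace 3 U" "U \<inter> \<Sigma> \<in> S"
    using L(1) by (auto simp: bb_lines_def)
  have \<rho>U: "\<rho> = U \<inter> \<Sigma>" using L(2) U(1) spread_plane_notin_pts[OF \<rho>] by auto
  \<comment> \<open>The subline comes with an embedding of its own; its two points are pulled back
    along the fixed embedding \<open>\<beta>\<close>.\<close>
  obtain X where "X \<in> pts UNIV" "\<beta> X = \<beta>' X'" by (rule B_preimage[OF IntD2[OF LB(1)]])
  moreover obtain Y where "Y \<in> pts UNIV" "\<beta> Y = \<beta>' Y'" by (rule B_preimage[OF IntD2[OF LB(2)]])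
  moreover from calculation ne have "X \<noteq> Y" by auto
  ultimately obtain m where "form 1 m" "\<And>u. u \<noteq> 0 \<Longrightarrow> m u *s c u + n u \<in> U"
    using secant_form[OF U(2,3), of X Y] LB U(1) assms(2) \<rho>U by auto
  with that U \<rho>U show ?thesis by blast
qed

text \<open>The line of the subplane through two prescribed points on different generators yields
  some linear form \<open>m'\<close>. It agrees with \<open>m\<close> at two independent parameters,
  hence everywhere.\<close>

lemma splash_contains:
  assumes m: "form 1 m"
  obtains U where "pspace 3 U" "U \<inter> \<Sigma> \<in> splash \<Sigma> S B" "\<And>u. u \<noteq> 0 \<Longrightarrow> m u *s c u + n u \<in> U"
proof -
  let ?u = "vector [1, 0] :: 'a ^ 2" and ?v = "vector [0, 1] :: 'a ^ 2"
  let ?x = "m ?u *s c ?u + n ?u" and ?y = "m ?v *s c ?v + n ?v"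
  have u: "?u \<noteq> 0" and v: "?v \<noteq> 0" by (simp_all add: vec_eq_iff forall_2)
  have "\<not> (\<exists>l. ?v = l *s ?u)" by (simp add: vec_eq_iff forall_2)
  then have nvu: "n ?v \<noteq> k *s n ?u" for k using n_unique[OF u v] by blast
  have gx: "g ?x \<noteq> 0" and gy: "g ?y \<noteq> 0" using g_affine u v by auto
  then have nz: "?x \<noteq> 0" "?y \<noteq> 0" using lfun_0[OF lfun_g] by auto
  have xB: "vec.span {?x} \<in> B" and yB: "vec.span {?y} \<in> B" using affine_surface_iff u v by blast+
  obtain X where X: "X \<in> pts UNIV" "\<beta> X = vec.span {?x}" by (rule B_preimage[OF xB])
  obtain Y where Y: "Y \<in> pts UNIV" "\<beta> Y = vec.span {?y}" by (rule B_preimage[OF yB])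
  have y_notin: "?y \<notin> vec.span {?x}"
  proof
    assume "?y \<in> vec.span {?x}"
    then obtain k where k: "?y = k *s ?x" by (auto simp: vec.span_singleton)
    then have "1 *s n ?v - k *s n ?u = (k * m ?u) *s c ?u - m ?v *s c ?v"
      by (simp add: vec_eq_iff algebra_simps)
    then have "1 *s n ?v - k *s n ?u \<in> E" by (metis vec.span_diff vec.span_scale c_in)
    from n_comb_E[OF this] nvu show False by simp
  qed
  have "X \<noteq> Y"
  proof
    assume "X = Y"
    then have "?y \<in> vec.span {?x}" using X Y vec.span_base[of ?y "{?y}"] by simp
    with y_notin show False by blast
  qed
  obtain k where k: "pspace 1 k" "X \<in> pts k" "Y \<in> pts k"
    and k_unique: "\<And>m'. pspace 1 m' \<Longrightarrow> X \<in> pts m' \<Longrightarrow> Y \<in> pts m' \<Longrightarrow> m' = k"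
    using line_through_points[OF X(1) Y(1) \<open>X \<noteq> Y\<close>] by metis
  obtain L where L: "L \<in> bb_lines \<Sigma> S" "\<beta> X \<in> L" "\<beta> Y \<in> L"
    using collinear_image[OF X(1) Y(1) Y(1)] k by blast
  have line_cases: "\<exists>U. L = bb_line U \<and> pspace 3 U \<and> U \<inter> \<Sigma> \<in> S \<and> ?x \<in> U \<and> ?y \<in> U"
    if L: "L \<in> bb_lines \<Sigma> S" "\<beta> X \<in> L" "\<beta> Y \<in> L" for L
  proof -
    obtain U where U: "L = bb_line U" "pspace 3 U" "U \<inter> \<Sigma> \<in> S" "?x \<in> U"
      by (rule bb_line_affine[OF L(1) L(2)[unfolded X(2)] gx])
    have "?y \<in> U" by (rule bb_line_point[OF U(2,3) nz(2) L(3)[unfolded U(1) Y(2)]])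
    with U show ?thesis by blast
  qed
  obtain U where U: "L = bb_line U" "pspace 3 U" "U \<inter> \<Sigma> \<in> S" and xy: "?x \<in> U" "?y \<in> U"
    using line_cases[OF L] by blast
  have sub: "vec.subspace U" using U(2) by (simp add: pspace_def)
  \<comment> \<open>Two affine points on a line through \<alpha> would agree modulo \<open>E\<close>
    up to a scalar, making two distinct points of the twisted cubic equal.\<close>
  have "U \<inter> \<Sigma> \<noteq> E"
  proof
    assume "U \<inter> \<Sigma> = E"
    then have "?y - (g ?y / g ?x) *s ?x \<in> E" using affine_decomp[OF sub xy(1) gx] xy(2) by blast
    then have "(?y - (g ?y / g ?x) *s ?x) - (m ?v *s c ?v - (g ?y / g ?x * m ?u) *s c ?u) \<in> E"
      by (rule vec.span_diff) (intro vec.span_diff vec.span_scale c_in)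
    moreover have "(?y - (g ?y / g ?x) *s ?x) - (m ?v *s c ?v - (g ?y / g ?x * m ?u) *s c ?u) 
      = 1 *s n ?v - (g ?y / g ?x) *s n ?u"
      by (simp add: vec_eq_iff algebra_simps)
    ultimately have "1 *s n ?v - (g ?y / g ?x) *s n ?u \<in> E" by simp
    from n_comb_E[OF this] nvu show False by simp
  qed
  have "\<beta> X \<in> bb_line U" "\<beta> Y \<in> bb_line U" using L U(1) by auto
  then obtain m' where m': "form 1 m'" "\<And>u. u \<noteq> 0 \<Longrightarrow> m' u *s c u + n u \<in> U"
    using secant_form[OF U(2,3) \<open>U \<inter> \<Sigma> \<noteq> E\<close> X(1) Y(1) \<open>X \<noteq> Y\<close>] by blast
  \<comment> \<open>Two points of \<open>U\<close> on one generator would differ by a multiple of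
    \<open>c z\<close>, but \<open>U\<close> misses \<open>E\<close>.\<close>
  have same: "m' z = m z" if z: "z \<noteq> 0" "m z *s c z + n z \<in> U" for z
  proof -
    have "(m' z *s c z + n z) - (m z *s c z + n z) \<in> U"
      using m'(2)[OF z(1)] z(2) sub by (intro vec.subspace_diff)
    then have "(m' z - m z) *s c z \<in> U" by (simp add: vec.scale_left_diff_distrib)
    then have "(m' z - m z) *s c z \<in> U \<inter> E" using vec.span_scale[OF c_in] by blast
    then show ?thesis using Int_E_zero[OF sub U(3) \<open>U \<inter> \<Sigma> \<noteq> E\<close>] c_nz[OF z(1)] by auto
  qed
  obtain a b where ab: "\<forall>u. m u = a * u $ 1 + b * u $ 2" by (rule linear_form_cases[OF m])
  obtain a' b' where ab': "\<forall>u. m' u = a' * u $ 1 + b' * u $ 2" by (rule linear_form_cases[OF m'(1)])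
  have "m' ?u = m ?u" "m' ?v = m ?v" using same u v xy by auto
  then have "m' z = m z" for z by (simp add: ab ab')
  then have mU: "m u *s c u + n u \<in> U" if "u \<noteq> 0" for u using m'(2)[OF that] by simp
  \<comment> \<open>Membership in the splash needs the full intersection to be a subline, so points
    are transferred in both directions through collinearity.\<close>
  have "L \<inter> B = \<beta> ` pts k"
  proof (intro equalityI subsetI)
    fix P assume P: "P \<in> L \<inter> B"
    obtain Z where Z: "Z \<in> pts UNIV" "\<beta> Z = P" by (rule B_preimage[OF IntD2[OF P]])
    have "\<beta> Z \<in> L" unfolding Z(2) by (rule IntD1[OF P])
    with L have "\<exists>m. pspace 1 m \<and> X \<in> pts m \<and> Y \<in> pts m \<and> Z \<in> pts m"
      unfolding collinear_image[OF X(1) Y(1) Z(1)] by (intro bexI[of _ L]) simp_all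
    then have "Z \<in> pts k" using k_unique by blast
    with Z show "P \<in> \<beta> ` pts k" by blast
  next
    fix P assume "P \<in> \<beta> ` pts k"
    then obtain Z where Z: "Z \<in> pts k" "P = \<beta> Z" by blast
    then have Z': "Z \<in> pts UNIV" by (auto simp: pts_def)
    obtain L' where L': "L' \<in> bb_lines \<Sigma> S" "\<beta> X \<in> L'" "\<beta> Y \<in> L'" "\<beta> Z \<in> L'"
      using collinear_image[OF X(1) Y(1) Z'] k Z by blast
    obtain U' where U': "L' = bb_line U'" "pspace 3 U'" "U' \<inter> \<Sigma> \<in> S" "?x \<in> U'" "?y \<in> U'"
      using line_cases[OF L'(1-3)] by blast
    have "U' = U" by (rule bb_space_unique[OF U'(2,3) U(2,3) U'(4) xy(1) gx U'(5) xy(2) y_notin])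
    with L' U U' have "\<beta> Z \<in> L" by simp
    moreover have "\<beta> Z \<in> B" unfolding image[symmetric] using Z' by (rule imageI)
    ultimately show "P \<in> L \<inter> B" using Z by blast
  qed
  then have "Fq_subline \<Sigma> S (L \<inter> B)" unfolding Fq_subline_def using embedding k(1) by blast
  then have "U \<inter> \<Sigma> \<in> splash \<Sigma> S B" using U L(1) unfolding splash_def by blast
  with U(2) mU that show ?thesis by blast
qed

text \<open>Forwards, \<open>h\<close> vanishes on the trace of the secant space \<open>U\<close>,
  so it is a multiple of \<open>g\<close> on \<open>U\<close>; evaluating it at the directrix points
  gives the identity. Backwards, the identity says that \<open>h + k g\<close> vanishes on the
  secant space of \<open>- m\<close>, whose trace must then be \<pi>.\<close>

lemma splash_iff:
  assumes \<pi>: "\<pi> \<in> S" "\<pi> \<noteq> E" and h: "lfun h" "\<And>x. x \<in> \<pi> \<Longrightarrow> h x = 0" "\<not> \<Sigma> \<subseteq> {x. h x = 0}"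
  shows "\<pi> \<in> splash \<Sigma> S B \<longleftrightarrow> (\<exists>k m. form 1 m \<and> (\<forall>u. h (n u) + k * g (n u) = m u * h (c u)))"
proof
  assume "\<pi> \<in> splash \<Sigma> S B"
  then obtain U m where U: "pspace 3 U" "\<pi> = U \<inter> \<Sigma>" and m: "form 1 m" "\<And>u. u \<noteq> 0 \<Longrightarrow> m u *s c u + n u \<in> U"
    using splash_cases[OF _ \<pi>(2)] by blast
  have "vec.subspace U" using U(1) by (simp add: pspace_def)
  then obtain k where k: "\<forall>y\<in>U. h y = k * g y"
    by (rule lfun_proportional_on[OF h(1) lfun_g]) (use h(2) U(2) \<Sigma>_eq in auto)
  have "h (n u) + (- k) * g (n u) = (- m u) * h (c u)" for u
  proof (cases "u = 0")
    \<comment> \<open>The divisibility identity is demanded for all vectors, so the zero parameter,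
      where the directrix points say nothing, is checked separately.\<close>
    case True
    then have "n u = 0" "c u = 0" using n_scale[of 0 u] c_scale[of 0 u] by auto
    then show ?thesis by (simp add: lfun_0 h(1) lfun_g)
  next
    case False
    then have "h (m u *s c u + n u) = k * g (m u *s c u + n u)" using k m(2) by blast
    then have "m u * h (c u) + h (n u) = k * g (n u)"
      by (simp add: lfun_add lfun_scale h(1) lfun_g g_c)
    then show ?thesis by (simp add: algebra_simps)
  qed
  with form_uminus[OF m(1)] show "\<exists>k m. form 1 m \<and> (\<forall>u. h (n u) + k * g (n u) = m u * h (c u))"
    by blast
next
  assume "\<exists>k m. form 1 m \<and> (\<forall>u. h (n u) + k * g (n u) = m u * h (c u))"
  then obtain k m where m: "form 1 m" "\<And>u. h (n u) + k * g (n u) = m u * h (c u)" by blast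
  obtain U where U: "pspace 3 U" "U \<inter> \<Sigma> \<in> splash \<Sigma> S B"
    "\<And>u. u \<noteq> 0 \<Longrightarrow> (- m u) *s c u + n u \<in> U"
    using splash_contains[OF form_uminus[OF m(1)]] by blast
  have sub: "vec.subspace U" "vec.dim U = 4" using U(1) by (auto simp: pspace_def)
  have in_S: "U \<inter> \<Sigma> \<in> S" using U(2) by (simp add: splash_def)
  \<comment> \<open>The directrix points span all of \<open>U\<close>, so it suffices to check that
    \<open>h + k g\<close> vanishes on them.\<close>
  let ?W = "vec.span {(- m u) *s c u + n u | u. u \<noteq> 0}"
  have "4 + vec.dim (?W \<inter> E) \<le> vec.dim ?W"
  proof (rule dim_ge_if_projection[OF vec.subspace_span form_0[of 1]])
    fix u :: "'a ^ 2" assume "u \<noteq> 0"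
    then have "(- m u) *s c u + 1 *s n u \<in> ?W" by (intro vec.span_base) auto
    then show "\<exists>a\<in>E. a + 1 *s n u \<in> ?W" using vec.span_scale[OF c_in] by blast
  qed (use q in auto)
  moreover have "?W \<subseteq> U" by (rule vec.span_minimal) (use U(3) sub in auto)
  ultimately have "?W = U" using sub by (intro vec.subspace_dim_equal) auto
  let ?h = "\<lambda>x. h x + k * g x"
  have lh: "lfun ?h" by (rule lfun_combine[OF h(1) lfun_g])
  have "{(- m u) *s c u + n u | u. u \<noteq> 0} \<subseteq> {x. ?h x = 0}"
  proof clarify
    fix u :: "'a ^ 2"
    show "?h ((- m u) *s c u + n u) = 0"
      using m(2)[of u] unfolding lfun_add[OF lh] lfun_scale[OF lh] by (simp add: g_c)
  qed
  then have "?W \<subseteq> {x. ?h x = 0}" by (rule vec.span_minimal[OF _ subspace_kernel[OF lh]])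
  with \<open>?W = U\<close> have h0: "h x = 0" if "x \<in> U \<inter> \<Sigma>" for x using that by (auto simp: \<Sigma>_eq)
  \<comment> \<open>Two different spread planes meet trivially and so span the 6-dimensional
    \<open>\<Sigma>\<close>, on which \<open>h\<close> is not zero.\<close>
  have "\<pi> = U \<inter> \<Sigma>"
  proof (rule ccontr)
    assume ne: "\<pi> \<noteq> U \<inter> \<Sigma>"
    let ?T = "\<Sigma> \<inter> {x. h x = 0}"
    have subT: "vec.subspace ?T" using subspace_\<Sigma> subspace_kernel[OF h(1)] by (rule vec.subspace_inter)
    have "\<pi> \<inter> (U \<inter> \<Sigma>) \<subseteq> {0}" using ne spread_disjoint[OF \<pi>(1) in_S] by blast
    then have "vec.dim (\<pi> \<inter> (U \<inter> \<Sigma>)) \<le> vec.dim {0 :: 'a ^ 7}" by (rule vec.dim_subset)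
    then have "vec.dim (\<pi> \<inter> (U \<inter> \<Sigma>)) = 0" by (simp add: vec.dim_insert)
    moreover have "vec.dim \<pi> + vec.dim (U \<inter> \<Sigma>) \<le> vec.dim ?T + vec.dim (\<pi> \<inter> (U \<inter> \<Sigma>))"
      by (rule dim_Int_ge) (use spread_plane \<pi>(1) in_S subT h(2) h0 in auto)
    ultimately have "vec.dim \<Sigma> \<le> vec.dim ?T" using spread_plane[OF \<pi>(1)] spread_plane[OF in_S] dim_\<Sigma> by linarith
    then have "?T = \<Sigma>" by (intro vec.subspace_dim_equal subT subspace_\<Sigma>) auto
    with h(3) show False by blast
  qed
  with U(2) show "\<pi> \<in> splash \<Sigma> S B" by simp
qed

end

section \<open>The pencil of hyperplanes\<close>

text \<open>Serves to count projective parameters without choosing representatives: conic points,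
  generators and values of \<open>\<kappa>\<close> are all images of one set of parameter vectors,
  with the same fibres.\<close>

lemma card_image_eq_if_same_fibres:
  assumes "\<And>x y. x \<in> R \<Longrightarrow> y \<in> R \<Longrightarrow> f x = f y \<longleftrightarrow> g x = g y"
  shows "card (f ` R) = card (g ` R)"
proof (rule bij_betw_same_card)
  let ?h = "\<lambda>z. g (inv_into R f z)"
  have h: "?h (f x) = g x" if "x \<in> R" for x
    using assms[of "inv_into R f (f x)" x] that by (simp add: inv_into_into f_inv_into_f)
  show "bij_betw ?h (f ` R) (g ` R)"
    unfolding bij_betw_def
  proof
    show "inj_on ?h (f ` R)"
    proof (rule inj_onI, elim imageE)
      fix z z' x y assume *: "?h z = ?h z'" "z = f x" "x \<in> R" "z' = f y" "y \<in> R"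
      then have "g x = g y" using h by metis
      with * assms show "z = z'" by blast
    qed
    show "?h ` f ` R = g ` R" unfolding image_image using h by (intro image_cong) auto
  qed
qed

context positioned_quintic
begin

text \<open>The affine part of the pencil spanned by \<open>h\<close> and \<open>g\<close>; the
  missing member \<open>k = \<infinity>\<close> is \<open>\<Sigma>\<close> itself.\<close>

definition pencil :: "('a ^ 7 \<Rightarrow> 'a) \<Rightarrow> 'a \<Rightarrow> ('a ^ 7) set"
  where "pencil h k = {x. h x + k * g x = 0}"

text \<open>As \<open>l\<close> lies in \<alpha>, it misses \<pi>, so the two span a hyperplane of
  \<open>\<Sigma>\<close>. Here \<open>h\<close> is chosen to cut out this hyperplane on
  \<open>\<Sigma>\<close>.\<close>

lemma five_spaces_pencil:
  assumes \<pi>: "\<pi> \<in> S" "\<pi> \<noteq> E" and l: "pspace 1 l" "l \<subseteq> E"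
  obtains h where "lfun h" "\<forall>x\<in>\<pi>. h x = 0" "\<forall>x\<in>l. h x = 0"
    "\<not> \<Sigma> \<subseteq> {x. h x = 0}" "five_spaces \<Sigma> \<pi> l = range (pencil h)" "inj (pencil h)"
proof -
  have sub: "vec.subspace \<pi>" "vec.subspace l" and dims: "vec.dim \<pi> = 3" "vec.dim l = 2"
    and \<pi>\<Sigma>: "\<pi> \<subseteq> \<Sigma>" and l\<Sigma>: "l \<subseteq> \<Sigma>"
    using spread_plane[OF \<pi>(1)] spread_plane[OF E_in_S] l by (auto simp: pspace_def)
  let ?T = "{x + y | x y. x \<in> \<pi> \<and> y \<in> l}"
  have subT: "vec.subspace ?T" by (rule vec.subspace_sums[OF sub])
  have \<pi>T: "\<pi> \<subseteq> ?T" using vec.subspace_0[OF sub(2)] by force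
  have lT: "l \<subseteq> ?T" using vec.subspace_0[OF sub(1)] by force
  have T\<Sigma>: "?T \<subseteq> \<Sigma>" using \<pi>\<Sigma> l\<Sigma> vec.subspace_add[OF subspace_\<Sigma>] by blast
  have "\<pi> \<inter> l \<subseteq> {0}" using spread_disjoint[OF \<pi>(1) E_in_S] \<pi>(2) l(2) by blast
  then have "vec.dim (\<pi> \<inter> l) \<le> vec.dim {0 :: 'a ^ 7}" by (rule vec.dim_subset)
  then have "vec.dim (\<pi> \<inter> l) = 0" using vec.dim_insert[of "0 :: 'a ^ 7" "{}"] by (simp add: vec.span_zero)
  with vec.dim_sums_Int[OF sub] dims have dimT: "vec.dim ?T = 5" by linarith
  then have "?T \<noteq> \<Sigma>" using dim_\<Sigma> by auto
  with T\<Sigma> obtain x1 where x1: "x1 \<in> \<Sigma>" "x1 \<notin> ?T" by blast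
  obtain h where h: "lfun h" "\<forall>y\<in>?T. h y = 0" "h x1 = 1" by (rule lfun_separating[OF subT x1(2)])
  have gx1: "g x1 = 0" using x1(1) by (simp add: \<Sigma>_eq)
  have not_sub: "\<not> \<Sigma> \<subseteq> {x. h x = 0}" using x1(1) h(3) by auto
  have lk: "lfun (\<lambda>x. h x + k * g x)" for k by (rule lfun_combine[OF h(1) lfun_g])
  have x1_notin: "x1 \<notin> pencil h k" for k by (simp add: pencil_def h(3) gx1)
  have sub_pencil: "vec.subspace (pencil h k)" for k unfolding pencil_def by (rule subspace_kernel[OF lk])
  have "vec.dim (pencil h k) + 1 = 7" for k
    using dim_kernel[OF lk[of k], of x1] x1_notin[of k] by (simp add: pencil_def)
  then have dim_pencil: "vec.dim (pencil h k) = 6" for k using add_right_imp_eq[of _ 1 6] by simp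
  have ker_T: "?T = \<Sigma> \<inter> {x. h x = 0}"
  proof (rule vec.subspace_dim_equal[OF subT vec.subspace_inter[OF subspace_\<Sigma> subspace_kernel[OF h(1)]]])
    show "?T \<subseteq> \<Sigma> \<inter> {x. h x = 0}" using T\<Sigma> h(2) by blast
    have "vec.dim (\<Sigma> \<inter> {x. h x = 0}) < vec.dim \<Sigma>"
    proof (rule ccontr)
      assume "\<not> ?thesis"
      then have "\<Sigma> \<inter> {x. h x = 0} = \<Sigma>"
        by (intro vec.subspace_dim_equal vec.subspace_inter subspace_\<Sigma> subspace_kernel h) auto
      with not_sub show False by blast
    qed
    then show "vec.dim (\<Sigma> \<inter> {x. h x = 0}) \<le> vec.dim ?T" using dim_\<Sigma> dimT by linarith
  qed
  have "pencil h k \<in> five_spaces \<Sigma> \<pi> l" for k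
  proof -
    have "?T \<subseteq> pencil h k"
    proof
      fix x assume x: "x \<in> ?T"
      then have "g x = 0" using T\<Sigma> \<Sigma>_eq by blast
      moreover have "h x = 0" using h(2) x by blast
      ultimately show "x \<in> pencil h k" by (simp add: pencil_def)
    qed
    then have "\<pi> \<subseteq> pencil h k" "l \<subseteq> pencil h k" using \<pi>T lT by auto
    moreover have "pencil h k \<noteq> \<Sigma>" using x1_notin x1(1) by blast
    ultimately show ?thesis by (simp add: five_spaces_def pspace_def sub_pencil dim_pencil)
  qed
  moreover have "H \<in> range (pencil h)" if "H \<in> five_spaces \<Sigma> \<pi> l" for H
  proof -
    have H: "vec.subspace H" "vec.dim H = 6" "\<pi> \<subseteq> H" "l \<subseteq> H" "H \<noteq> \<Sigma>"
      using that by (auto simp: five_spaces_def pspace_def)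
    obtain h' x' where h': "lfun h'" "h' x' \<noteq> 0" "H = {y. h' y = 0}"
      using hyperplane_kernel[OF H(1)] H(2) by auto
    have "?T \<subseteq> H" using H(3,4) vec.subspace_add[OF H(1)] by blast
    \<comment> \<open>An equation \<open>h'\<close> of \<open>H\<close> is first compared with
      \<open>h\<close> on \<open>\<Sigma>\<close>; then the difference \<open>h' - a h\<close>,
      which vanishes on \<open>\<Sigma>\<close>, is compared with \<open>g\<close>.\<close>
    then have "h' y = 0" if "y \<in> \<Sigma>" "h y = 0" for y using that ker_T h'(3) by blast
    from lfun_proportional_on[OF h'(1) h(1) subspace_\<Sigma> this]
    obtain a where a: "\<forall>y\<in>\<Sigma>. h' y = a * h y" by blast
    have "a \<noteq> 0"
    proof
      assume "a = 0"
      then have "\<Sigma> \<subseteq> H" using a h'(3) by auto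
      then have "\<Sigma> = H" using H dim_\<Sigma> subspace_\<Sigma> by (intro vec.subspace_dim_equal) auto
      with H(5) show False by simp
    qed
    have "h' y + (- a) * h y = 0" if "g y = 0" for y using a that by (simp add: \<Sigma>_eq)
    from lfun_proportional_on[OF lfun_combine[OF h'(1) h(1)] lfun_g vec.subspace_UNIV this]
    obtain b where b: "\<forall>y\<in>UNIV. h' y + (- a) * h y = b * g y" by blast
    then have eq: "h' y = a * (h y + (b / a) * g y)" for y
      using \<open>a \<noteq> 0\<close> b[rule_format, of y] by (simp add: distrib_left diff_eq_eq add.commute)
    have "H = pencil h (b / a)" unfolding h'(3) pencil_def eq using \<open>a \<noteq> 0\<close> by simp
    then show ?thesis by blast
  qed
  ultimately have range: "five_spaces \<Sigma> \<pi> l = range (pencil h)" by blast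
  have "inj (pencil h)"
  proof (rule injI)
    fix k k' assume eq: "pencil h k = pencil h k'"
    let ?y = "n (vector [1, 0])"
    \<comment> \<open>A vector off \<open>\<Sigma>\<close>, corrected along \<open>x1\<close> (where
      \<open>h\<close> is 1 and \<open>g\<close> is 0) so that it lies in the member
      \<open>k\<close>.\<close>
    let ?x = "?y - (h ?y + k * g ?y) *s x1"
    have "h ?x + k * g ?x = 0" by (simp add: lfun_diff lfun_scale h(1,3) lfun_g gx1)
    then have "?x \<in> pencil h k'" unfolding eq[symmetric] by (simp add: pencil_def)
    then have "h ?x + k' * g ?x = 0" by (simp add: pencil_def)
    then have "h ?y - (h ?y + k * g ?y) + k' * g ?y = 0"
      by (simp add: lfun_diff lfun_scale h(1,3) lfun_g gx1)
    then have "(k' - k) * g ?y = 0" by (simp add: algebra_simps)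
    then show "k = k'" using g_n[OF vector_1_neq_0[of 0]] by simp
  qed
  then show ?thesis using that[OF h(1) _ _ not_sub range] h(2) \<pi>T lT by blast
qed

section \<open>Types of sections and their numbers\<close>

definition divides :: "('a ^ 7 \<Rightarrow> 'a) \<Rightarrow> bool"
  where "divides h \<longleftrightarrow> (\<exists>m. form 1 m \<and> (\<forall>u. h (n u) = m u * h (c u)))"

text \<open>For a functional \<open>h\<close>, this says that its hyperplane contains a
  generator.\<close>

definition common_root :: "('a ^ 7 \<Rightarrow> 'a) \<Rightarrow> bool"
  where "common_root h \<longleftrightarrow> (\<exists>u. u \<noteq> 0 \<and> h (c u) = 0 \<and> h (n u) = 0)"

abbreviation gens where "gens \<equiv> gen ` {u. u \<noteq> 0}"

lemma span_c_eq_iff: "u \<noteq> 0 \<Longrightarrow> v \<noteq> 0 \<Longrightarrow> vec.span {c u} = vec.span {c v} \<longleftrightarrow> (\<exists>k. k \<noteq> 0 \<and> v = k *s u)"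
proof
  assume u: "u \<noteq> 0" and v: "v \<noteq> 0" and "vec.span {c u} = vec.span {c v}"
  then obtain k where "c v = k *s c u" using span_singleton_eqD c_nz[OF v] by metis
  from c_unique[OF u v this] v show "\<exists>k. k \<noteq> 0 \<and> v = k *s u" by auto
qed (auto simp: c_scale span_singleton_scale)

lemma common_root_if_contains_generator:
  assumes "lfun h" "u \<noteq> 0" "pts (gen u) \<subseteq> pts {x. h x = 0}"
  shows "common_root h"
proof -
  have "vec.span {c u} \<in> pts (gen u)" "vec.span {n u} \<in> pts (gen u)"
    using c_nz[OF assms(2)] n_nz[OF assms(2)] by (simp_all add: gen_def span_in_pts_iff vec.span_base)
  then have "vec.span {c u} \<in> pts {x. h x = 0}" "vec.span {n u} \<in> pts {x. h x = 0}" using assms(3) by auto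
  then have "h (c u) = 0" "h (n u) = 0"
    using c_nz[OF assms(2)] n_nz[OF assms(2)] 
    by (simp_all add: span_in_pts_iff[OF subspace_kernel[OF assms(1)]])
  with assms(2) show ?thesis unfolding common_root_def by blast
qed

text \<open>Keeps unintended members out of the counted sets: a hyperplane that contains no
  generator can satisfy the predicate only with no generators at all.\<close>

lemma meets_without_common_root:
  assumes "lfun h" "\<not> common_root h" "meets_in_nrc_and_generators surface gens r k {x. h x = 0}"
  shows "nrc r (pts {x. h x = 0} \<inter> surface)" "k = 0"
proof -
  obtain N K where NK: "nrc r N" "K \<subseteq> gens" "card K = k" 
    "pts {x. h x = 0} \<inter> surface = N \<union> (\<Union>g\<in>K. pts g)"
    using assms(3) unfolding meets_in_nrc_and_generators_def by blast
  have "K = {}"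
  proof (rule ccontr)
    assume "K \<noteq> {}"
    then obtain u where u: "u \<noteq> 0" "gen u \<in> K" using NK(2) by blast
    then have "pts (gen u) \<subseteq> pts {x. h x = 0} \<inter> surface" unfolding NK(4) by blast
    then show False using common_root_if_contains_generator[OF assms(1) u(1)] assms(2) by blast
  qed
  with NK show "nrc r (pts {x. h x = 0} \<inter> surface)" "k = 0" by auto
qed

lemma nrc_dim_unique: "nrc r N \<Longrightarrow> nrc s N \<Longrightarrow> r \<le> 5 \<Longrightarrow> s \<le> 5 \<Longrightarrow> r = s" for N :: "('a ^ 7) set set"
  using dim_nrc[of r N] dim_nrc[of s N] q by simp

text \<open>Two independent linear forms divide both \<open>h \<circ> c\<close> and
  \<open>h \<circ> n\<close>, and they already exhaust the quadratic form \<open>h \<circ> c\<close>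
  up to a scalar.\<close>

lemma divides_if_two_common_roots:
  assumes h: "lfun h" "h (c w) \<noteq> 0"
    and u: "u \<noteq> 0" "h (c u) = 0" "h (n u) = 0" and v: "v \<noteq> 0" "h (c v) = 0" "h (n v) = 0"
    and ne: "\<And>k. v \<noteq> k *s u"
  shows "divides h"
proof -
  let ?l = "\<lambda>w u :: 'a ^ 2. w $ 1 * u $ 2 - w $ 2 * u $ 1"
  have "?l u v \<noteq> 0" using proportional_if_det_0[OF u(1), of v] ne by (metis eq_iff_diff_eq_0)
  obtain a where a: "form 1 a" "\<And>x. h (c x) = ?l u x * a x"
    using form_factor[of 1 "\<lambda>u. h (c u)" u] form_c[OF h(1)] u by (auto simp: numeral_2_eq_2)
  obtain b where b: "form 2 b" "\<And>x. h (n x) = ?l u x * b x"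
    using form_factor[of 2 "\<lambda>u. h (n u)" u] form_n[OF h(1)] u by (auto simp: numeral_3_eq_3)
  have "a v = 0" "b v = 0" using a(2)[of v] b(2)[of v] v \<open>?l u v \<noteq> 0\<close> by auto
  obtain a' where a': "form 0 a'" "\<And>x. a x = ?l v x * a' x"
    using form_factor[of 0 a v] a(1) v(1) \<open>a v = 0\<close> by auto
  obtain k where k: "\<forall>x. a' x = k" by (rule formE[OF a'(1)]) auto
  obtain m where m: "form 1 m" "\<And>x. b x = ?l v x * m x"
    using form_factor[of 1 b v] b(1) v(1) \<open>b v = 0\<close> by (auto simp: numeral_2_eq_2)
  have "k \<noteq> 0" using h(2) a a' k by auto
  then have "h (n x) = (1 / k * m x) * h (c x)" for x by (simp add: a b a' m k)
  then show ?thesis unfolding divides_def using form_cmult[OF m(1)] by blast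
qed

text \<open>All members of the pencil restrict to the same form on the conic, since \<open>g\<close>
  vanishes there; only the cubic form moves with \<open>k\<close>. The shapes are counted by asking
  for which \<open>k\<close> there is a common root or divisibility.\<close>

lemma hyperplane_sections:
  assumes \<pi>: "\<pi> \<in> S" "\<pi> \<noteq> E" and l: "pspace 1 l" "l \<subseteq> E"
    and i: "card (pts l \<inter> {vec.span {c u} | u. u \<noteq> 0}) = i"
  shows "card (five_spaces \<Sigma> \<pi> l) = CARD('a)"
    and "\<pi> \<in> splash \<Sigma> S B \<Longrightarrow>
      card {H \<in> five_spaces \<Sigma> \<pi> l. nrc 5 (pts H \<inter> surface)} = CARD('a) - 1 \<and>
      card {H \<in> five_spaces \<Sigma> \<pi> l. meets_in_nrc_and_generators surface gens 3 i H} = 1"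
    and "\<pi> \<notin> splash \<Sigma> S B \<Longrightarrow>
      card {H \<in> five_spaces \<Sigma> \<pi> l. nrc 5 (pts H \<inter> surface)} = CARD('a) - i \<and>
      card {H \<in> five_spaces \<Sigma> \<pi> l. meets_in_nrc_and_generators surface gens 4 1 H} = i"
proof -
  obtain h where h: "lfun h" "\<forall>x\<in>\<pi>. h x = 0" "\<forall>x\<in>l. h x = 0"
    "\<not> \<Sigma> \<subseteq> {x. h x = 0}" and five: "five_spaces \<Sigma> \<pi> l = range (pencil h)" and inj: "inj (pencil h)"
    by (rule five_spaces_pencil[OF \<pi> l])
  show "card (five_spaces \<Sigma> \<pi> l) = CARD('a)" by (simp add: five card_image inj)
  define hk where "hk k x = h x + k * g x" for k x
  have hk: "lfun (hk k)" for k unfolding hk_def by (rule lfun_combine[OF h(1) lfun_g])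
  have pencil: "pencil h k = {x. hk k x = 0}" for k by (simp add: pencil_def hk_def)
  have hkc: "hk k (c u) = h (c u)" for k u by (simp add: hk_def g_c)
  have card_Collect: "card {H \<in> five_spaces \<Sigma> \<pi> l. Q H} = card {k. Q (pencil h k)}" for Q
  proof -
    have "{H \<in> five_spaces \<Sigma> \<pi> l. Q H} = pencil h ` {k. Q (pencil h k)}" unfolding five by blast
    then show ?thesis using inj by (simp add: card_image inj_on_subset)
  qed
  have splash: "\<pi> \<in> splash \<Sigma> S B \<longleftrightarrow> (\<exists>k. divides (hk k))"
    using splash_iff[OF \<pi> h(1) _ h(4)] h(2) by (simp add: divides_def hk_def g_c)
  \<comment> \<open>Otherwise \<open>h\<close> would vanish on two different spread planes, hence on
    \<open>\<Sigma>\<close>.\<close>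
  have "\<not> E \<subseteq> {x. h x = 0}"
  proof
    assume E0: "E \<subseteq> {x. h x = 0}"
    let ?T = "\<Sigma> \<inter> {x. h x = 0}"
    have subT: "vec.subspace ?T" using subspace_\<Sigma> subspace_kernel[OF h(1)] by (rule vec.subspace_inter)
    have "\<pi> \<inter> E \<subseteq> {0}" using \<pi>(2) spread_disjoint[OF \<pi>(1) E_in_S] by blast
    then have "vec.dim (\<pi> \<inter> E) \<le> vec.dim {0 :: 'a ^ 7}" by (rule vec.dim_subset)
    then have "vec.dim (\<pi> \<inter> E) = 0" using vec.dim_insert[of "0 :: 'a ^ 7" "{}"] by (simp add: vec.span_zero)
    moreover have "vec.dim \<pi> + vec.dim E \<le> vec.dim ?T + vec.dim (\<pi> \<inter> E)"
      by (rule dim_Int_ge) (use spread_plane[OF \<pi>(1)] spread_plane[OF E_in_S] subT h(2) E0 in auto)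
    ultimately have "vec.dim \<Sigma> \<le> vec.dim ?T" using spread_plane[OF \<pi>(1)] dim_E dim_\<Sigma> by linarith
    then have "?T = \<Sigma>" by (intro vec.subspace_dim_equal subT subspace_\<Sigma>) auto
    with h(4) show False by blast
  qed
  then have "\<not> {c u | u. u \<noteq> 0} \<subseteq> {x. h x = 0}"
    unfolding span_c[symmetric] using vec.span_minimal[OF _ subspace_kernel[OF h(1)]] by blast
  then obtain v where v: "v \<noteq> 0" "h (c v) \<noteq> 0" by blast
  have l_eq: "l = E \<inter> {x. h x = 0}"
  proof (rule vec.subspace_dim_equal)
    show "vec.subspace l" using l by (simp add: pspace_def)
    show subEh: "vec.subspace (E \<inter> {x. h x = 0})"
      by (rule vec.subspace_inter[OF vec.subspace_span subspace_kernel[OF h(1)]])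
    show "l \<subseteq> E \<inter> {x. h x = 0}" using l h(3) by blast
    have "vec.dim (E \<inter> {x. h x = 0}) < vec.dim E"
    proof (rule ccontr)
      assume "\<not> ?thesis"
      then have "E \<inter> {x. h x = 0} = E"
        by (intro vec.subspace_dim_equal subEh vec.subspace_span) auto
      with \<open>\<not> E \<subseteq> {x. h x = 0}\<close> show False by blast
    qed
    then show "vec.dim (E \<inter> {x. h x = 0}) \<le> vec.dim l" using l dim_E by (simp add: pspace_def)
  qed
  \<comment> \<open>Because \<open>h\<close> cuts out exactly \<open>l\<close> on the conic plane,
    these are the parameter vectors of the \<open>i\<close> points of \<open>l\<close> on the conic,
    each point occurring with all its scalar multiples.\<close>
  define R where "R = {u. u \<noteq> 0 \<and> h (c u) = 0}"
  have "pts l \<inter> {vec.span {c u} | u. u \<noteq> 0} = (\<lambda>u. vec.span {c u}) ` R"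
  proof -
    have "vec.span {c u} \<in> pts l \<longleftrightarrow> h (c u) = 0" if "u \<noteq> 0" for u
      using span_in_pts_iff[of l, OF _ c_nz[OF that]] l(1) c_in by (simp add: pspace_def) (simp add: l_eq)
    then show ?thesis unfolding R_def by blast
  qed
  with i have i_eq: "card ((\<lambda>u. vec.span {c u}) ` R) = i" by simp
  have card_gen: "card (gen ` R) = i"
    unfolding i_eq[symmetric] by (rule card_image_eq_if_same_fibres) (simp add: R_def gen_eq_iff span_c_eq_iff)
  have no_root: "common_root (hk k) \<longleftrightarrow> (\<exists>u\<in>R. hk k (n u) = 0)" for k
    by (auto simp: common_root_def hkc R_def)
  have nrc5: "nrc 5 (pts (pencil h k) \<inter> surface)" if "\<not> common_root (hk k)" "\<not> divides (hk k)" for k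
    unfolding pencil using that v
    by (intro section_coprime[OF hk]) (auto simp: common_root_def divides_def hkc)
  have not_nrc5: "\<not> nrc 5 (pts (pencil h k) \<inter> surface)" if "common_root (hk k)" for k
    unfolding pencil using that not_nrc_if_common_root[OF hk] unfolding common_root_def by blast
  {
    assume "\<pi> \<in> splash \<Sigma> S B"
    then obtain k0 m where m: "form 1 m" "\<And>u. hk k0 (n u) = m u * h (c u)"
      unfolding splash divides_def hkc by blast
    \<comment> \<open>At a zero of \<open>h \<circ> c\<close> only the second term remains, and
      \<open>g (n u)\<close> is never zero; so common roots can occur for \<open>k0\<close>
      only.\<close>
    have shift: "hk k (n u) = m u * h (c u) + (k - k0) * g (n u)" for k u
      using m(2)[of u] by (simp add: hk_def algebra_simps)
    have root: "k = k0" if cr: "common_root (hk k)" for k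
    proof -
      obtain u where "u \<in> R" "hk k (n u) = 0" using cr unfolding no_root by blast
      then show ?thesis using shift[of k u] g_n[of u] by (simp add: R_def)
    qed
    have div: "k = k0" if dv: "divides (hk k)" for k
    proof -
      obtain m' where m': "form 1 m'" "\<And>u. hk k (n u) = m' u * h (c u)"
        using dv unfolding divides_def hkc by blast
      \<comment> \<open>If a second member were divisible with quotient \<open>m'\<close>, then at a
        root of \<open>m' - m\<close> the identity would read
        \<open>(k - k0) * g (n w) = 0\<close>.\<close>
      obtain w where w: "w \<noteq> 0" "m' w - m w = 0"
        using linear_form_root[OF form_diff[OF m'(1) m(1)]] by blast
      have "(k - k0) * g (n w) = (m' w - m w) * h (c w)"
        using m'(2)[of w] shift[of k w] by (simp add: algebra_simps)
      with w g_n[OF w(1)] show ?thesis by simp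
    qed
    have eq: "hk k0 (n u) = m u * hk k0 (c u)" for u unfolding hkc by (rule m(2))
    obtain N where N: "nrc 3 N" "pts (pencil h k0) \<inter> surface = N \<union> (\<Union>u\<in>R. pts (gen u))"
      unfolding pencil R_def hkc[symmetric, of _ k0] by (rule section_divides[OF hk[of k0] m(1) eq])
    \<comment> \<open>If \<open>i = 0\<close>, the member \<open>k0\<close> contains no generator,
      and its section is excluded by dimension: it is a twisted cubic.\<close>
    have k0: "\<not> nrc 5 (pts (pencil h k0) \<inter> surface)"
    proof (cases "common_root (hk k0)")
      case False
      have "R = {}" using False m(2) unfolding no_root by (auto simp: R_def)
      then show ?thesis using N nrc_dim_unique[of 3 N 5] by auto
    qed (rule not_nrc5)
    then have "{k. nrc 5 (pts (pencil h k) \<inter> surface)} = UNIV - {k0}"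
      using nrc5 root div by blast
    then have card1: "card {k. nrc 5 (pts (pencil h k) \<inter> surface)} = CARD('a) - 1"
      by (simp add: card_Diff_subset)
    have "meets_in_nrc_and_generators surface gens 3 i (pencil h k0)"
      unfolding meets_in_nrc_and_generators_def
      by (rule exI[of _ N], rule exI[of _ "gen ` R"]) (use N card_gen in \<open>auto simp: R_def\<close>)
    moreover have "k = k0" if "meets_in_nrc_and_generators surface gens 3 i (pencil h k)" for k
    proof (rule ccontr)
      assume "k \<noteq> k0"
      then have nr: "\<not> common_root (hk k)" "\<not> divides (hk k)" using root div by auto
      then have "nrc 3 (pts (pencil h k) \<inter> surface)"
        using meets_without_common_root(1)[OF hk, of k 3 i] that unfolding pencil by blast
      with nrc5[OF nr] nrc_dim_unique[of 3 _ 5] show False by auto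
    qed
    ultimately have "{k. meets_in_nrc_and_generators surface gens 3 i (pencil h k)} = {k0}" by blast
    with card1 show "card {H \<in> five_spaces \<Sigma> \<pi> l. nrc 5 (pts H \<inter> surface)} = CARD('a) - 1 \<and>
        card {H \<in> five_spaces \<Sigma> \<pi> l. meets_in_nrc_and_generators surface gens 3 i H} = 1"
      by (simp add: card_Collect)
  next
    assume "\<pi> \<notin> splash \<Sigma> S B"
    then have no_div: "\<not> divides (hk k)" for k unfolding splash by blast
    \<comment> \<open>The only member of the pencil whose cubic form vanishes at \<open>u\<close>.
      Numerator and denominator have the same degree, so the value depends only on the projective
      parameter.\<close>
    define \<kappa> where "\<kappa> u = - h (n u) / g (n u)" for u
    have root_iff: "hk k (n u) = 0 \<longleftrightarrow> k = \<kappa> u" if "u \<in> R" for k u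
      using g_n[of u] that by (auto simp: hk_def \<kappa>_def R_def field_simps eq_neg_iff_add_eq_0)
    \<comment> \<open>Two conic points with the same member would give it two common roots and hence
      divisibility, which is impossible outside the splash. So the \<open>i\<close> points of
      \<open>l\<close> on the conic use up exactly \<open>i\<close> members.\<close>
    have "\<kappa> u = \<kappa> v' \<longleftrightarrow> vec.span {c u} = vec.span {c v'}" if u: "u \<in> R" and v': "v' \<in> R" for u v'
    proof -
      have nz: "u \<noteq> 0" "v' \<noteq> 0" using u v' by (auto simp: R_def)
      have "\<exists>k. v' = k *s u" if eq: "\<kappa> u = \<kappa> v'"
      proof (rule ccontr)
        assume "\<nexists>k. v' = k *s u"
        then have "divides (hk (\<kappa> u))"
          using root_iff[OF u, of "\<kappa> u"] root_iff[OF v', of "\<kappa> u"] eq u v' v(2) nz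
          by (intro divides_if_two_common_roots[OF hk, of _ v u v']) (auto simp: hkc R_def)
        with no_div show False by blast
      qed
      moreover have "\<kappa> u = \<kappa> v'" if "k \<noteq> 0" "v' = k *s u" for k
        using that(1) unfolding that(2) by (simp add: \<kappa>_def n_scale lfun_scale h(1) lfun_g)
      moreover have "k \<noteq> 0" if "v' = k *s u" for k using that nz(2) by auto
      ultimately show ?thesis unfolding span_c_eq_iff[OF nz] by blast
    qed
    then have "card (\<kappa> ` R) = i" unfolding i_eq[symmetric] by (rule card_image_eq_if_same_fibres)
    moreover have "{k. common_root (hk k)} = \<kappa> ` R" unfolding no_root using root_iff by auto
    ultimately have card_root: "card {k. common_root (hk k)} = i" by simp
    have "{k. nrc 5 (pts (pencil h k) \<inter> surface)} = UNIV - {k. common_root (hk k)}"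
      using nrc5 not_nrc5 no_div by blast
    then have card1: "card {k. nrc 5 (pts (pencil h k) \<inter> surface)} = CARD('a) - i"
      by (simp add: card_Diff_subset card_root)
    have "meets_in_nrc_and_generators surface gens 4 1 (pencil h k)" if root: "common_root (hk k)" for k
    proof -
      obtain r where r: "r \<noteq> 0" "hk k (c r) = 0" "hk k (n r) = 0" using root unfolding common_root_def by blast
      have nd: "\<exists>u. hk k (n u) \<noteq> m u * hk k (c u)" if "form 1 m" for m
        using no_div[of k] that unfolding divides_def by blast
      have hv: "hk k (c v) \<noteq> 0" by (simp add: hkc v(2))
      obtain N where "nrc 4 N" "pts (pencil h k) \<inter> surface = N \<union> pts (gen r)"
        unfolding pencil by (rule section_common_root[OF hk[of k] hv r nd])
      then show ?thesis unfolding meets_in_nrc_and_generators_def using r(1)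
        by (intro exI[of _ N] exI[of _ "{gen r}"]) simp
    qed
    moreover have "common_root (hk k)" if "meets_in_nrc_and_generators surface gens 4 1 (pencil h k)" for k
      using meets_without_common_root(2)[OF hk, of k 4 1] that unfolding pencil by auto
    ultimately have "{k. meets_in_nrc_and_generators surface gens 4 1 (pencil h k)} = {k. common_root (hk k)}"
      by blast
    with card1 card_root show "card {H \<in> five_spaces \<Sigma> \<pi> l. nrc 5 (pts H \<inter> surface)} = CARD('a) - i \<and>
        card {H \<in> five_spaces \<Sigma> \<pi> l. meets_in_nrc_and_generators surface gens 4 1 H} = i"
      by (simp add: card_Collect)
  }
qed

end

section \<open>Absorbing the projectivity and assembling the theorem\<close>

text \<open>Substituting \<open>M\<close> gives forms of the same degree with new coefficient
  vectors \<open>f'\<close>. As \<open>M\<close> permutes the non-zero parameters, the values and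
  hence their span are unchanged, and the dimension makes \<open>f'\<close> a frame.\<close>

lemma curve_reparametrise:
  fixes f :: "nat \<Rightarrow> 'a::{field,finite} ^ 'n"
  assumes "frame r f" "invertible M" "r < CARD('a)"
  obtains f' where "frame r f'" "vec.span (f' ` {..r}) = vec.span (f ` {..r})"
    "\<And>u. curve_pt r f (M *v u) = curve_pt r f' u"
proof -
  define w where "w u = (\<Sum>i\<le>r. ((u $ 1) ^ (r - i) * (u $ 2) ^ i) *s f i)" for u :: "'a ^ 2"
  have "vform r w" unfolding vform_iff w_def by blast
  then have "vform r (\<lambda>u. w (M *v u))" by (rule vform_compose_matrix)
  then obtain f' where f': "\<forall>u. w (M *v u) = (\<Sum>i\<le>r. ((u $ 1) ^ (r - i) * (u $ 2) ^ i) *s f' i)"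
    unfolding vform_iff by blast
  obtain M' where M': "M ** M' = mat 1" "M' ** M = mat 1" using assms(2) unfolding invertible_def by blast
  have "{w (M *v u) | u. u \<noteq> 0} = {w u | u. u \<noteq> 0}"
  proof (intro equalityI subsetI)
    fix x assume "x \<in> {w (M *v u) | u. u \<noteq> 0}"
    then obtain u where u: "u \<noteq> 0" "x = w (M *v u)" by blast
    have "M *v u \<noteq> 0"
    proof
      assume "M *v u = 0"
      then have "M' *v (M *v u) = 0" by simp
      with u(1) show False by (simp add: matrix_vector_mul_assoc M')
    qed
    with u show "x \<in> {w u | u. u \<noteq> 0}" by blast
  next
    fix x assume "x \<in> {w u | u. u \<noteq> 0}"
    then obtain u where u: "u \<noteq> 0" "x = w u" by blast
    have Mu: "M *v (M' *v u) = u" by (simp add: matrix_vector_mul_assoc M')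
    with u have "M' *v u \<noteq> 0" by auto
    moreover have "x = w (M *v (M' *v u))" using u(2) by (simp only: Mu)
    ultimately show "x \<in> {w (M *v u) | u. u \<noteq> 0}" by blast
  qed
  then have span: "vec.span (f' ` {..r}) = vec.span (f ` {..r})"
    using span_vform[OF f'[rule_format] assms(3)] span_vform[OF w_def assms(3)] by simp
  then have "vec.dim (f' ` {..r}) = r + 1" using dim_frame[OF assms(1)] by (metis vec.dim_span)
  then have "frame r f'" by (intro frame_if_dim) simp
  moreover have "curve_pt r f (M *v u) = curve_pt r f' u" for u
    using f' by (simp add: curve_pt_def w_def)
  ultimately show ?thesis using that span by blast
qed

theorem theorem5p1:
  fixes \<Sigma> :: "('a::{field,finite} ^ 7) set"
    and S V C G B :: "('a ^ 7) set set"
    and \<alpha> \<pi> l :: "('a ^ 7) set"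
    and i :: nat
  assumes "CARD('a) \<ge> 6"
    and "pspace 5 \<Sigma>"
    and "regular_spread2 \<Sigma> S"
    and "ruled_quintic V C G"
    and "V \<inter> pts \<Sigma> = C"
    and "\<alpha> \<in> S"
    and "C \<subseteq> pts \<alpha>"
    and "B = (V - pts \<Sigma>) \<union> {\<alpha>}"
    and "Fq_subplane \<Sigma> S B"
    and "B \<inter> S = {\<alpha>}"
    and "pspace 1 l"
    and "l \<subseteq> \<alpha>"
    and "card (pts l \<inter> C) = i"
    and "\<pi> \<in> S"
    and "\<pi> \<noteq> \<alpha>"
  shows "card (five_spaces \<Sigma> \<pi> l) = CARD('a) \<and>
    (\<pi> \<in> splash \<Sigma> S B - {\<alpha>} \<longrightarrow>
       card {H \<in> five_spaces \<Sigma> \<pi> l. \<exists>N. nrc 5 N \<and> pts H \<inter> V = N} = CARD('a) - 1 \<and>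
       card {H \<in> five_spaces \<Sigma> \<pi> l. meets_in_nrc_and_generators V G 3 i H} = 1) \<and>
    (\<pi> \<in> S - splash \<Sigma> S B \<longrightarrow>
       card {H \<in> five_spaces \<Sigma> \<pi> l. \<exists>N. nrc 5 N \<and> pts H \<inter> V = N} = CARD('a) - i \<and>
       card {H \<in> five_spaces \<Sigma> \<pi> l. meets_in_nrc_and_generators V G 4 1 H} = i)"
proof -
  obtain e f0 and M :: "'a ^ 2 ^ 2" where frames: "frame 2 e" "frame 3 f0"
    and disj: "pts (vec.span (e ` {..2})) \<inter> pts (vec.span (f0 ` {..3})) = {}"
    and M: "invertible M" and C: "C = curve 2 e"
    and G: "G = {vec.span (curve_pt 2 e u \<union> curve_pt 3 f0 (M *v u)) | u. u \<noteq> 0}"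
    and V: "V = (\<Union>g\<in>G. pts g)"
    using assms(4) unfolding ruled_quintic_def by blast
  have "3 < CARD('a)" using assms(1) by simp
  then obtain f where f: "frame 3 f" "vec.span (f ` {..3}) = vec.span (f0 ` {..3})"
    "\<And>u. curve_pt 3 f0 (M *v u) = curve_pt 3 f u"
    using curve_reparametrise[OF frames(2) M] by blast
  interpret quintic e f
  proof
    show "vec.span (e ` {..2}) \<inter> vec.span (f ` {..3}) = {0}"
    proof (rule subspace_Int_zero[OF vec.subspace_span vec.subspace_span], rule ccontr)
      fix x assume "x \<in> vec.span (e ` {..2})" "x \<in> vec.span (f ` {..3})" "x \<noteq> 0"
      then have "vec.span {x} \<in> pts (vec.span (e ` {..2})) \<inter> pts (vec.span (f0 ` {..3}))"
        by (simp add: span_in_pts_iff f(2))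
      with disj show False by blast
    qed
  qed (fact assms(1) frames(1) f(1))+
  have pt: "curve_pt 2 e u = vec.span {c u}" "curve_pt 3 f u = vec.span {n u}" for u
    by (simp_all add: curve_pt_def c_def n_def)
  have C': "C = {vec.span {c u} | u. u \<noteq> 0}" by (simp add: C curve_def pt)
  have "vec.span (vec.span {c u} \<union> vec.span {n u}) = gen u" for u
  proof -
    have "vec.span {c u} \<union> vec.span {n u} \<subseteq> vec.span {c u, n u}" by (simp add: vec.span_mono)
    moreover have "{c u, n u} \<subseteq> vec.span (vec.span {c u} \<union> vec.span {n u})"
      by (auto intro!: vec.span_base)
    ultimately show ?thesis unfolding gen_def vec.span_eq by blast
  qed
  then have G': "G = gen ` {u. u \<noteq> 0}" by (auto simp: G f(3) pt)
  have V': "V = surface" by (simp add: V G' surface_def)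
  have sub\<Sigma>: "vec.subspace \<Sigma>" "vec.dim \<Sigma> = 6" using assms(2) by (auto simp: pspace_def)
  obtain g x0 where g: "lfun g" "g x0 \<noteq> 0" "\<Sigma> = {y. g y = 0}"
    using hyperplane_kernel[OF sub\<Sigma>(1)] sub\<Sigma>(2) by auto
  have spread: "spread2 \<Sigma> S" using assms(3) by (simp add: regular_spread2_def)
  then have \<alpha>: "vec.subspace \<alpha>" "vec.dim \<alpha> = 3" using assms(6) by (auto simp: spread2_def pspace_def)
  have "c u \<in> \<alpha>" if "u \<noteq> 0" for u
  proof -
    have "vec.span {c u} \<in> pts \<alpha>" using that assms(7) C' by blast
    then show ?thesis by (simp add: span_in_pts_iff[OF \<alpha>(1) c_nz[OF that]])
  qed
  then have "{c u | u. u \<noteq> 0} \<subseteq> \<alpha>" by blast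
  \<comment> \<open>The points of the conic span its plane, so the plane of the conic is the spread
    plane \<alpha>.\<close>
  then have "E \<subseteq> \<alpha>" unfolding span_c[symmetric] using \<alpha>(1) by (rule vec.span_minimal)
  then have E: "E = \<alpha>" using \<alpha> dim_E by (intro vec.subspace_dim_equal) simp_all
  \<comment> \<open>A point of the twisted cubic at infinity would belong to the conic by the
    positioning of the surface, although its 3-space misses the conic plane.\<close>
  have g_n: "g (n u) \<noteq> 0" if u: "u \<noteq> 0" for u
  proof
    assume "g (n u) = 0"
    then have "vec.span {n u} \<in> pts \<Sigma>" using span_in_pts_iff[OF sub\<Sigma>(1) n_nz[OF u]] by (simp add: g(3))
    moreover have "vec.span {n u} \<in> V" unfolding V' surface_iff using u
      by (intro exI[of _ u] exI[of _ 0] exI[of _ 1]) simp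
    ultimately have "vec.span {n u} \<in> pts \<alpha>" using assms(5,7) by blast
    then have "n u \<in> E" using n_nz[OF u] by (simp add: span_in_pts_iff E \<alpha>)
    with n_notin_E[OF u] show False by blast
  qed
  obtain \<beta> where \<beta>: "Fq_embedding \<Sigma> S \<beta>" "B = \<beta> ` pts UNIV"
    using assms(9) unfolding Fq_subplane_def by blast
  interpret positioned_quintic e f \<Sigma> S \<beta> g
  proof
    show "E \<in> S" unfolding E by (rule assms(6))
    show "\<beta> ` pts UNIV = (surface - pts \<Sigma>) \<union> {E}"
      unfolding \<beta>(2)[symmetric] assms(8) V' E by (rule refl)
  qed (fact g(1,3) spread g_n \<beta>(1))+
  have ex: "(\<exists>N. nrc 5 N \<and> pts H \<inter> V = N) \<longleftrightarrow> nrc 5 (pts H \<inter> surface)" for H unfolding V' by blast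
  have B: "B = (surface - pts \<Sigma>) \<union> {E}" by (simp add: assms(8) V' E)
  have "\<pi> \<noteq> E" "l \<subseteq> E" "card (pts l \<inter> {vec.span {c u} | u. u \<noteq> 0}) = i"
    using assms(12,13,15) by (simp_all add: E C')
  note result = hyperplane_sections[OF assms(14) this(1) assms(11) this(2,3)]
  show ?thesis unfolding ex unfolding V' G' B using result by blast
qed

end
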